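(* Let $P=\{p_1,\dots,p_d\}$ and $Q=\{q_1,\dots,q_d\}$ be finite posets with $P\cap Q=\emptyset$, and let $\Gamma(P,Q)=\mathrm{conv}\big(\mathcal C(P)\cup(-\mathcal C(Q))\big)\subset\mathbb R^d$ be their twinned chain polytope. Then $$N(\Gamma(P,Q))\le\begin{cases}6^{d/2} & \text{if } d \text{ is even},\\ 14\cdot 6^{(d-3)/2} & \text{if } d \text{ is odd}.\end{cases}$$ Moreover, when $d$ is even, $N(\Gamma(P,Q))=6^{d/2}$ holds if and only if $P\cong \mathbf I_2\oplus\cdots\oplus\mathbf I_2$, $Q\cong \mathbf I_2\oplus\cdots\oplus\mathbf I_2$ (with $d/2$ summands), and the map $\varphi:P\to Q$, $\varphi(p_i)=q_i$, is a graph isomorphism from the comparability graph $G_P$ to the comparability graph $G_Q$.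
   Context: For a finite poset $P=\{p_1,\dots,p_d\}$, an antichain is a set of pairwise incomparable elements (including $\emptyset$ and singletons); for an antichain $A$ put $\rho(A)=\sum_{p_i\in A}\mathbf e_i\in\mathbb R^d$, where $\mathbf e_i$ are the standard unit vectors. The chain polytope is $\mathcal C(P)=\mathrm{conv}\{\rho(A): A \text{ antichain of } P\}\subset\mathbb R^d$. For posets $P=\{p_1,\dots,p_d\}$, $Q=\{q_1,\dots,q_d\}$ (coordinate $i$ corresponds to both $p_i$ and $q_i$), $\Gamma(P,Q)=\mathrm{conv}(\mathcal C(P)\cup(-\mathcal C(Q)))$. $N(\mathcal P)$ denotes the number of facets of a polytope $\mathcal P$. $\mathbf I_n$ is the $n$-element antichain poset. The ordinal sum $P\oplus Q$ of posets on disjoint sets is the poset on $P\cup Q$ with $s\le t$ iff ($s,t\in P$ and $s\le_P t$) or ($s,t\in Q$ and $s\le_Q t$) or ($s\in P$, $t\in Q$). The comparability graph $G_P$ has vertex set $P$ and an edge $\{x,y\}$ for each pair of distinct comparable elements. *)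

theory Defs
  imports "HOL-Analysis.Analysis"
begin

text \<open>A poset is a pair of its underlying set and its (reflexive) order relation.\<close>

type_synonym 'a poset = "'a set \<times> 'a rel"

definition is_poset :: "'a poset \<Rightarrow> bool" where
  "is_poset P \<longleftrightarrow> partial_order_on (fst P) (snd P)"

definition comparable :: "'a poset \<Rightarrow> 'a \<Rightarrow> 'a \<Rightarrow> bool" where
  "comparable P x y \<longleftrightarrow> (x, y) \<in> snd P \<or> (y, x) \<in> snd P"

definition antichain_of :: "'a poset \<Rightarrow> 'a set \<Rightarrow> bool" where
  "antichain_of P A \<longleftrightarrow> A \<subseteq> fst P \<and> (\<forall>x\<in>A. \<forall>y\<in>A. x \<noteq> y \<longrightarrow> \<not> comparable P x y)"

text \<open>The map \<open>p\<close> is the labelling \<open>i \<mapsto> p\<^sub>i\<close> of the elements of the poset by the coordinates.\<close>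

definition rho :: "('n::finite \<Rightarrow> 'a) \<Rightarrow> 'a set \<Rightarrow> real ^ 'n" where
  "rho p A = (\<Sum>i\<in>{i. p i \<in> A}. axis i 1)"

definition chain_polytope :: "'a poset \<Rightarrow> ('n::finite \<Rightarrow> 'a) \<Rightarrow> (real ^ 'n) set" where
  "chain_polytope P p = convex hull {rho p A |A. antichain_of P A}"

definition twinned_chain_polytope ::
  "'a poset \<Rightarrow> ('n::finite \<Rightarrow> 'a) \<Rightarrow> 'a poset \<Rightarrow> ('n \<Rightarrow> 'a) \<Rightarrow> (real ^ 'n) set" where
  "twinned_chain_polytope P p Q q =
     convex hull (chain_polytope P p \<union> uminus ` chain_polytope Q q)"

definition num_facets :: "'v::euclidean_space set \<Rightarrow> nat" where
  "num_facets S = card {F. F facet_of S}"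

definition poset_iso :: "'a poset \<Rightarrow> 'b poset \<Rightarrow> bool" where
  "poset_iso P Q \<longleftrightarrow>
     (\<exists>f. bij_betw f (fst P) (fst Q) \<and>
          (\<forall>x\<in>fst P. \<forall>y\<in>fst P. (x, y) \<in> snd P \<longleftrightarrow> (f x, f y) \<in> snd Q))"

definition antichain_poset :: "'a set \<Rightarrow> 'a poset" where
  "antichain_poset A = (A, Id_on A)"

text \<open>Meaningful for posets with disjoint underlying sets only.\<close>

definition ordinal_sum :: "'a poset \<Rightarrow> 'a poset \<Rightarrow> 'a poset" where
  "ordinal_sum P Q = (fst P \<union> fst Q, snd P \<union> snd Q \<union> fst P \<times> fst Q)"

text \<open>The ordinal sum of \<open>k\<close> copies of the two-element antichain, the \<open>j\<close>-th copy (counted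
  from \<open>0\<close>) being realised on \<open>{2 * j, 2 * j + 1}\<close>, so that the copies are disjoint.\<close>

primrec ordinal_sum_I2 :: "nat \<Rightarrow> nat poset" where
  "ordinal_sum_I2 0 = antichain_poset {}"
| "ordinal_sum_I2 (Suc k) = ordinal_sum (ordinal_sum_I2 k) (antichain_poset {2 * k, 2 * k + 1})"

text \<open>A simple graph is a pair of its vertex set and its set of two-element edges.\<close>

definition comparability_graph :: "'a poset \<Rightarrow> 'a set \<times> 'a set set" where
  "comparability_graph P =
     (fst P, {{x, y} |x y. x \<in> fst P \<and> y \<in> fst P \<and> x \<noteq> y \<and> comparable P x y})"

definition graph_isomorphism ::
  "('a \<Rightarrow> 'b) \<Rightarrow> 'a set \<times> 'a set set \<Rightarrow> 'b set \<times> 'b set set \<Rightarrow> bool" where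
  "graph_isomorphism f G H \<longleftrightarrow>
     bij_betw f (fst G) (fst H) \<and>
     (\<forall>x\<in>fst G. \<forall>y\<in>fst G. {x, y} \<in> snd G \<longleftrightarrow> {f x, f y} \<in> snd H)"

end

theory Submission
  imports Defs
begin

text \<open>
  Write \<open>g\<close> and \<open>h\<close> for the incomparability graphs of \<open>P\<close> and \<open>Q\<close> on the common index set, so that
  chains are independent sets. Since \<open>x \<ge> 0\<close> lies in the chain polytope iff all its chain sums are at
  most one, splitting a vector into positive and negative part gives \<open>\<Gamma>(P, Q)\<close> as the set of all \<open>x\<close>
  with \<open>x(C) - x(D) \<le> 1\<close> for all disjoint pairs of a chain \<open>C\<close> of \<open>P\<close> and a chain \<open>D\<close> of \<open>Q\<close>. The
  irredundant inequalities are those of the pairs for which every index outside \<open>C \<union> D\<close> has a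
  \<open>g\<close>-neighbour in \<open>C\<close> or an \<open>h\<close>-neighbour in \<open>D\<close>, and these inequalities define distinct facets.

  These pairs are counted for arbitrary graphs \<open>g\<close>, \<open>h\<close> by induction on the number of vertices. If the
  status of the vertices outside \<open>R\<close> is prescribed, at most as many pairs remain as there are pairs
  for \<open>R\<close>. Branching on the status of one vertex, whose neighbours are then left with only two
  possibilities each, gives the bound from the degrees of that vertex; a few sparse configurations
  require a second branching. In odd dimension the last remaining configuration, in which the two
  degrees of each vertex add up to three, is excluded by the handshake lemma. In even dimension every
  vertex for which \<open>g\<close> and \<open>h\<close> do not have one and the same single neighbour makes the bound strict.
\<close>

section \<open>Counting dominating pairs\<close>

definition independent_in :: "('v \<Rightarrow> 'v \<Rightarrow> bool) \<Rightarrow> 'v set \<Rightarrow> bool" where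
  "independent_in g C \<longleftrightarrow> (\<forall>x\<in>C. \<forall>y\<in>C. \<not> g x y)"

definition indep_pairs :: "('v \<Rightarrow> 'v \<Rightarrow> bool) \<Rightarrow> ('v \<Rightarrow> 'v \<Rightarrow> bool) \<Rightarrow> 'v set \<Rightarrow> ('v set \<times> 'v set) set" where
  "indep_pairs g h V = {(C, D). C \<subseteq> V \<and> D \<subseteq> V \<and> C \<inter> D = {} \<and> independent_in g C \<and> independent_in h D}"

definition dominating_pairs :: "('v \<Rightarrow> 'v \<Rightarrow> bool) \<Rightarrow> ('v \<Rightarrow> 'v \<Rightarrow> bool) \<Rightarrow> 'v set \<Rightarrow> ('v set \<times> 'v set) set" where
  "dominating_pairs g h V = {(C, D) \<in> indep_pairs g h V. \<forall>x\<in>V - C - D. (\<exists>y\<in>C. g x y) \<or> (\<exists>y\<in>D. h x y)}"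

lemma indep_pairs_subset: "indep_pairs g h V \<subseteq> Pow V \<times> Pow V"
  by (auto simp: indep_pairs_def)

lemma finite_indep_pairs: "finite V \<Longrightarrow> finite (indep_pairs g h V)"
  using finite_subset[OF indep_pairs_subset] by blast

lemma finite_dominating_pairs: "finite V \<Longrightarrow> finite (dominating_pairs g h V)"
  by (rule finite_subset[of _ "indep_pairs g h V"]) (auto simp: dominating_pairs_def finite_indep_pairs)

text \<open>This symmetry allows only one of two configurations that differ by exchanging
  \<open>g\<close> and \<open>h\<close> to be treated.\<close>

lemma card_dominating_pairs_swap: "card (dominating_pairs h g V) = card (dominating_pairs g h V)"
proof -
  have "dominating_pairs h g V = prod.swap ` dominating_pairs g h V"
  proof (intro subset_antisym subsetI)
    fix e assume "e \<in> dominating_pairs h g V"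
    then have "prod.swap e \<in> dominating_pairs g h V"
      by (auto simp: dominating_pairs_def indep_pairs_def; blast)
    then show "e \<in> prod.swap ` dominating_pairs g h V" by (rule rev_image_eqI) simp
  next
    fix e assume "e \<in> prod.swap ` dominating_pairs g h V"
    then show "e \<in> dominating_pairs h g V"
      by (auto simp: dominating_pairs_def indep_pairs_def; blast)
  qed
  then show ?thesis by (simp add: card_image)
qed

text \<open>The argument is an integer, so that the recursion \<open>facet_bound n = 6 * facet_bound (n - 2)\<close> holds
  without side conditions; the value \<open>7 / 3\<close> at \<open>1\<close> exceeds the true maximum \<open>2\<close> and is chosen to give
  \<open>14\<close> at \<open>3\<close>.\<close>

definition facet_bound :: "int \<Rightarrow> real" where
  "facet_bound n = (if even n then 1 else 7 / 3) * 6 powi (n div 2)"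

lemma facet_bound_pos: "facet_bound n > 0"
  by (simp add: facet_bound_def)

lemma facet_bound_minus_2: "facet_bound (n - 2) = facet_bound n / 6"
proof -
  have "(n - 2) div 2 = n div 2 - 1" by presburger
  then show ?thesis by (simp add: facet_bound_def power_int_diff)
qed

text \<open>All shifted bounds become multiples of the single positive number
  \<open>facet_bound n\<close>, so every case estimate below reduces to comparing a sum of fractions
  with one.\<close>

lemma facet_bound_even:
  assumes "even n"
  shows "facet_bound (n - 1) = 7 / 18 * facet_bound n" "facet_bound (n - 2) = 1 / 6 * facet_bound n"
    "facet_bound (n - 3) = 7 / 108 * facet_bound n" "facet_bound (n - 4) = 1 / 36 * facet_bound n"
    "facet_bound (n - 5) = 7 / 648 * facet_bound n"
proof -
  have "(n - 1) div 2 = n div 2 - 1" using assms by presburger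
  then show 1: "facet_bound (n - 1) = 7 / 18 * facet_bound n"
    using assms by (simp add: facet_bound_def power_int_diff)
  show 2: "facet_bound (n - 2) = 1 / 6 * facet_bound n" by (simp add: facet_bound_minus_2)
  show 3: "facet_bound (n - 3) = 7 / 108 * facet_bound n" and "facet_bound (n - 4) = 1 / 36 * facet_bound n"
    using facet_bound_minus_2[of "n - 1"] facet_bound_minus_2[of "n - 2"] 1 2 by simp_all
  show "facet_bound (n - 5) = 7 / 648 * facet_bound n"
    using facet_bound_minus_2[of "n - 3"] 3 by simp
qed

lemma facet_bound_odd:
  assumes "odd n"
  shows "facet_bound (n - 1) = 3 / 7 * facet_bound n" "facet_bound (n - 2) = 1 / 6 * facet_bound n"
    "facet_bound (n - 3) = 1 / 14 * facet_bound n" "facet_bound (n - 4) = 1 / 36 * facet_bound n"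
    "facet_bound (n - 5) = 1 / 84 * facet_bound n" "facet_bound (n - 6) = 1 / 216 * facet_bound n"
    "facet_bound (n - 7) = 1 / 504 * facet_bound n"
proof -
  have "(n - 1) div 2 = n div 2" using assms by presburger
  then show 1: "facet_bound (n - 1) = 3 / 7 * facet_bound n"
    using assms by (simp add: facet_bound_def)
  show 2: "facet_bound (n - 2) = 1 / 6 * facet_bound n" by (simp add: facet_bound_minus_2)
  show 3: "facet_bound (n - 3) = 1 / 14 * facet_bound n"
    using facet_bound_minus_2[of "n - 1"] 1 by simp
  show 4: "facet_bound (n - 4) = 1 / 36 * facet_bound n"
    using facet_bound_minus_2[of "n - 2"] 2 by simp
  show 5: "facet_bound (n - 5) = 1 / 84 * facet_bound n"
    using facet_bound_minus_2[of "n - 3"] 3 by simp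
  show "facet_bound (n - 6) = 1 / 216 * facet_bound n"
    using facet_bound_minus_2[of "n - 4"] 4 by simp
  show "facet_bound (n - 7) = 1 / 504 * facet_bound n"
    using facet_bound_minus_2[of "n - 5"] 5 by simp
qed

section \<open>Neighbourhoods and the handshake lemma\<close>

definition neighbours :: "('v \<Rightarrow> 'v \<Rightarrow> bool) \<Rightarrow> 'v set \<Rightarrow> 'v \<Rightarrow> 'v set" where
  "neighbours g V v = {u\<in>V. g v u}"

text \<open>By induction on the vertex set: a new vertex \<open>x\<close> contributes each of its
  edges twice, once from either end.\<close>

lemma even_sum_degrees:
  assumes "finite V" and sym: "\<And>x y. g x y \<Longrightarrow> g y x" and irr: "\<And>x. \<not> g x x"
  shows "even (\<Sum>v\<in>V. card (neighbours g V v))"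
  unfolding neighbours_def
  using \<open>finite V\<close>
proof (induction V rule: finite_induct)
  case (insert x V)
  have 1: "card {u \<in> insert x V. g v u} = card {u\<in>V. g v u} + (if g v x then 1 else 0)" for v
  proof -
    have "{u \<in> insert x V. g v u} = (if g v x then insert x {u\<in>V. g v u} else {u\<in>V. g v u})" by auto
    then show ?thesis using insert by simp
  qed
  have 2: "(\<Sum>v\<in>V. if g v x then 1 else 0) = card {u\<in>V. g x u}"
  proof -
    have "{u\<in>V. g x u} = {u\<in>V. g u x}" using sym by auto
    then show ?thesis using insert by (simp add: sum.If_cases Int_def)
  qed
  have "(\<Sum>v\<in>insert x V. card {u\<in>insert x V. g v u})
      = 2 * card {u\<in>V. g x u} + (\<Sum>v\<in>V. card {u\<in>V. g v u})"
    using insert irr by (simp add: 1 2 sum.distrib del: insert_iff)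
  then show ?case using insert by simp
qed simp

section \<open>Restriction of dominating pairs to a subset of the vertices\<close>

locale two_graphs =
  fixes g h :: "'v \<Rightarrow> 'v \<Rightarrow> bool"
  assumes g_sym: "g x y \<Longrightarrow> g y x" and g_irrefl: "\<not> g x x"
    and h_sym: "h x y \<Longrightarrow> h y x" and h_irrefl: "\<not> h x x"
begin

text \<open>The trace of a pair on \<open>R\<close> is completed to a dominating pair of \<open>R\<close> by adding vertices to the first
  component only if they have a neighbour in \<open>C0\<close> and to the second one only if they have a neighbour
  in \<open>D0\<close>. Such vertices cannot belong to the trace, so the trace can be recovered.\<close>

lemma card_dominating_pairs_restrict:
  assumes "finite V" "R \<subseteq> V"
  shows "card {(C, D) \<in> dominating_pairs g h V. C - R = C0 \<and> D - R = D0} \<le> card (dominating_pairs g h R)"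
proof -
  let ?A = "{(C, D) \<in> dominating_pairs g h V. C - R = C0 \<and> D - R = D0}"
  define U where "U = {x. \<exists>y\<in>C0. g x y}"
  define W where "W = {x. \<exists>y\<in>D0. h x y}"
  have finR: "finite R" using assms finite_subset by blast
  have ex: "\<exists>C1 D1. (C1, D1) \<in> dominating_pairs g h R \<and> C1 - U = C \<inter> R \<and> D1 - W = D \<inter> R"
    if CD: "(C, D) \<in> ?A" for C D
  proof -
    \<comment> \<open>A completion in \<open>E\<close> of largest total size is dominating: an
      undominated vertex of \<open>R\<close> was dominated by \<open>(C, D)\<close>, necessarily
      from outside \<open>R\<close>, so it lies in \<open>U\<close> or \<open>W\<close> and could
      still be added without leaving \<open>E\<close>.\<close>
    define E where "E = {(C1, D1) \<in> indep_pairs g h R. C1 - U = C \<inter> R \<and> D1 - W = D \<inter> R}"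
    have CU: "C \<inter> U = {}" "D \<inter> W = {}"
      using CD by (auto simp: dominating_pairs_def indep_pairs_def independent_in_def U_def W_def)
    have "(C \<inter> R, D \<inter> R) \<in> E"
      using CD CU by (auto simp: E_def dominating_pairs_def indep_pairs_def independent_in_def)
    moreover have "finite E"
      by (rule finite_subset[OF _ finite_indep_pairs[OF finR]]) (auto simp: E_def)
    ultimately have "Max ((\<lambda>e. card (fst e) + card (snd e)) ` E) \<in> (\<lambda>e. card (fst e) + card (snd e)) ` E"
      by (intro Max_in) auto
    then obtain e where e: "e \<in> E"
      and "card (fst e) + card (snd e) = Max ((\<lambda>e. card (fst e) + card (snd e)) ` E)" by auto
    then have mx: "card (fst e') + card (snd e') \<le> card (fst e) + card (snd e)" if "e' \<in> E" for e'
      using that \<open>finite E\<close> by simp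
    obtain C1 D1 where e12: "e = (C1, D1)" by (cases e)
    have sub: "C1 \<subseteq> R" "D1 \<subseteq> R" "C1 \<inter> D1 = {}" "independent_in g C1" "independent_in h D1"
      "C1 - U = C \<inter> R" "D1 - W = D \<inter> R"
      using e by (auto simp: e12 E_def indep_pairs_def)
    have fin1: "finite C1" "finite D1" using sub finR finite_subset by blast+
    have "(\<exists>y\<in>C1. g x y) \<or> (\<exists>y\<in>D1. h x y)" if x: "x \<in> R - C1 - D1" for x
    proof (rule ccontr)
      assume no: "\<not> ((\<exists>y\<in>C1. g x y) \<or> (\<exists>y\<in>D1. h x y))"
      have "x \<in> V - C - D" using x sub assms(2) by blast
      then have "(\<exists>y\<in>C. g x y) \<or> (\<exists>y\<in>D. h x y)" using CD by (auto simp: dominating_pairs_def)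
      then have "x \<in> U \<or> x \<in> W" using no sub CD by (auto simp: U_def W_def)
      then show False
      proof
        assume "x \<in> U"
        then have "(insert x C1, D1) \<in> E"
          using sub x no g_sym g_irrefl by (auto simp: E_def indep_pairs_def independent_in_def)
        from mx[OF this] show False using fin1 x by (simp add: e12)
      next
        assume "x \<in> W"
        then have "(C1, insert x D1) \<in> E"
          using sub x no h_sym h_irrefl by (auto simp: E_def indep_pairs_def independent_in_def)
        from mx[OF this] show False using fin1 x by (simp add: e12)
      qed
    qed
    then have "(C1, D1) \<in> dominating_pairs g h R"
      using sub by (auto simp: dominating_pairs_def indep_pairs_def)
    then show ?thesis using sub by blast
  qed
  define f where "f = (\<lambda>(C, D). SOME e. e \<in> dominating_pairs g h R \<and> fst e - U = C \<inter> R \<and> snd e - W = D \<inter> R)"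
  have f: "f (C, D) \<in> dominating_pairs g h R \<and> fst (f (C, D)) - U = C \<inter> R \<and> snd (f (C, D)) - W = D \<inter> R"
    if "(C, D) \<in> ?A" for C D
    unfolding f_def prod.case
    by (rule someI_ex) (use ex[OF that] in auto)
  have "inj_on f ?A"
  proof (rule inj_onI, clarify)
    fix C D C' D'
    assume a: "(C, D) \<in> dominating_pairs g h V" "(C', D') \<in> dominating_pairs g h V"
      "f (C, D) = f (C', D')" "C0 = C - R" "D0 = D - R" "C' - R = C - R" "D' - R = D - R"
    then have "C \<inter> R = C' \<inter> R" "D \<inter> R = D' \<inter> R"
      using f[of C D] f[of C' D'] by auto
    then show "C = C' \<and> D = D'" using a by blast
  qed
  then show ?thesis
    by (rule card_inj_on_le) (use f finite_dominating_pairs[OF finR] in auto)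
qed

end

section \<open>The induction step: branching on the status of a vertex\<close>

lemma two_graphs_swap: "two_graphs g h \<Longrightarrow> two_graphs h g"
  by (auto simp: two_graphs_def)

text \<open>With the induction hypothesis as a locale assumption, each degree configuration is a
  lemma of its own, and its mirror image comes from interpreting the locale with \<open>g\<close>
  and \<open>h\<close> exchanged.\<close>

locale induction_step = two_graphs +
  fixes V :: "'v set"
  assumes finite_V: "finite V"
    and IH: "R \<subset> V \<Longrightarrow> real (card (dominating_pairs g h R)) \<le> facet_bound (int (card R))"
begin

abbreviation d :: int where "d \<equiv> int (card V)"

abbreviation total :: real where "total \<equiv> real (card (dominating_pairs g h V))"

definition cnt :: "('v set \<Rightarrow> 'v set \<Rightarrow> bool) \<Rightarrow> real" where
  "cnt P = real (card {(C, D) \<in> dominating_pairs g h V. P C D})"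

abbreviation Ng :: "'v \<Rightarrow> 'v set" where "Ng \<equiv> neighbours g V"

abbreviation Nh :: "'v \<Rightarrow> 'v set" where "Nh \<equiv> neighbours h V"

lemma finite_N [simp]: "finite (Ng v)" "finite (Nh v)"
  using finite_V by (auto simp: neighbours_def)

lemma N_sym: "u \<in> Ng v \<Longrightarrow> v \<in> V \<Longrightarrow> v \<in> Ng u" "u \<in> Nh v \<Longrightarrow> v \<in> V \<Longrightarrow> v \<in> Nh u"
  using g_sym h_sym by (auto simp: neighbours_def)

lemma N_V: "u \<in> Ng v \<Longrightarrow> u \<in> V" "u \<in> Nh v \<Longrightarrow> u \<in> V"
  by (auto simp: neighbours_def)

lemma N_irrefl: "v \<notin> Ng v" "v \<notin> Nh v"
  using g_irrefl h_irrefl by (auto simp: neighbours_def)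

lemma pairD:
  assumes "(C, D) \<in> dominating_pairs g h V"
  shows "v \<in> C \<Longrightarrow> v \<notin> D" "v \<in> D \<Longrightarrow> v \<notin> C"
    "v \<in> C \<Longrightarrow> u \<in> Ng v \<Longrightarrow> u \<notin> C" "v \<in> D \<Longrightarrow> u \<in> Nh v \<Longrightarrow> u \<notin> D"
    "v \<in> V \<Longrightarrow> v \<notin> C \<Longrightarrow> v \<notin> D \<Longrightarrow> (\<exists>u\<in>Ng v. u \<in> C) \<or> (\<exists>u\<in>Nh v. u \<in> D)"
proof -
  have *: "C \<subseteq> V" "D \<subseteq> V" "C \<inter> D = {}" "independent_in g C" "independent_in h D"
    "\<forall>x\<in>V - C - D. (\<exists>y\<in>C. g x y) \<or> (\<exists>y\<in>D. h x y)"
    using assms by (auto simp: dominating_pairs_def indep_pairs_def)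
  show "v \<in> C \<Longrightarrow> v \<notin> D" "v \<in> D \<Longrightarrow> v \<notin> C" using *(3) by blast+
  show "v \<in> C \<Longrightarrow> u \<in> Ng v \<Longrightarrow> u \<notin> C" "v \<in> D \<Longrightarrow> u \<in> Nh v \<Longrightarrow> u \<notin> D"
    using *(4,5) by (auto simp: independent_in_def neighbours_def)
  assume "v \<in> V" "v \<notin> C" "v \<notin> D"
  then have "(\<exists>y\<in>C. g v y) \<or> (\<exists>y\<in>D. h v y)" using *(6) by blast
  then show "(\<exists>u\<in>Ng v. u \<in> C) \<or> (\<exists>u\<in>Nh v. u \<in> D)"
    using *(1,2) by (auto simp: neighbours_def)
qed

lemma dominated:
  assumes "(C, D) \<in> dominating_pairs g h V" "v \<in> V" "Ng v = A" "Nh v = B"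
  shows "v \<in> C \<or> v \<in> D \<or> (\<exists>u\<in>A. u \<in> C) \<or> (\<exists>u\<in>B. u \<in> D)"
  using pairD(5)[OF assms(1,2)] assms(3,4) by blast

lemma finite_cnt: "finite {(C, D) \<in> dominating_pairs g h V. P C D}"
  by (rule finite_subset[OF _ finite_dominating_pairs[OF finite_V]]) auto

lemma cnt_le:
  assumes "finite I" "\<And>C D. (C, D) \<in> dominating_pairs g h V \<Longrightarrow> P C D \<Longrightarrow> \<exists>i\<in>I. Q i C D"
  shows "cnt P \<le> (\<Sum>i\<in>I. cnt (Q i))"
proof -
  have "card {(C, D) \<in> dominating_pairs g h V. P C D} \<le> card (\<Union>i\<in>I. {(C, D) \<in> dominating_pairs g h V. Q i C D})"
    by (rule card_mono) (use assms finite_cnt in auto)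
  also have "\<dots> \<le> (\<Sum>i\<in>I. card {(C, D) \<in> dominating_pairs g h V. Q i C D})"
    by (rule card_UN_le) fact
  finally show ?thesis unfolding cnt_def by (metis (no_types, lifting) of_nat_le_iff of_nat_sum sum.cong)
qed

lemma cnt_le_2:
  assumes "\<And>C D. (C, D) \<in> dominating_pairs g h V \<Longrightarrow> P C D \<Longrightarrow> Q C D \<or> R C D"
  shows "cnt P \<le> cnt Q + cnt R"
  using cnt_le[of "{True, False}" P "\<lambda>b. if b then Q else R"] assms by auto

lemma cnt_le_3:
  assumes "\<And>C D. (C, D) \<in> dominating_pairs g h V \<Longrightarrow> P C D \<Longrightarrow> Q C D \<or> R C D \<or> S C D"
  shows "cnt P \<le> cnt Q + cnt R + cnt S"
  using cnt_le_2[of P Q "\<lambda>C D. R C D \<or> S C D"] cnt_le_2[of "\<lambda>C D. R C D \<or> S C D" R S] assms by fastforce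

lemma total_le: "total \<le> cnt (\<lambda>C D. v \<in> C) + cnt (\<lambda>C D. v \<in> D) + cnt (\<lambda>C D. v \<notin> C \<and> v \<notin> D)"
proof -
  have "total = cnt (\<lambda>C D. True)" by (simp add: cnt_def)
  also have "\<dots> \<le> cnt (\<lambda>C D. v \<in> C) + cnt (\<lambda>C D. v \<in> D) + cnt (\<lambda>C D. v \<notin> C \<and> v \<notin> D)"
    by (rule cnt_le_3) auto
  finally show ?thesis .
qed

text \<open>\<open>T\<close> collects the vertices of prescribed status. Each vertex of
  \<open>S\<close> is barred from one and the same component by all counted pairs, so it has two
  states left; branching on them moves \<open>S\<close> into \<open>T\<close> one vertex at a time.
  At each of the \<open>2 ^ card S\<close> leaves the restriction lemma and the induction hypothesis
  apply, the latter because \<open>T\<close> is non-empty.\<close>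

lemma cnt_pattern:
  assumes "finite S" "T \<subseteq> V" "S \<subseteq> V" "T \<inter> S = {}" "T \<noteq> {}"
    and "\<And>C D. (C, D) \<in> dominating_pairs g h V \<Longrightarrow> P C D \<Longrightarrow> C \<inter> T = C0 \<and> D \<inter> T = D0"
    and "\<And>s. s \<in> S \<Longrightarrow> (\<forall>C D. (C, D) \<in> dominating_pairs g h V \<longrightarrow> P C D \<longrightarrow> s \<notin> C) \<or>
           (\<forall>C D. (C, D) \<in> dominating_pairs g h V \<longrightarrow> P C D \<longrightarrow> s \<notin> D)"
  shows "cnt P \<le> 2 ^ card S * facet_bound (d - int (card T + card S))"
  using assms
proof (induction S arbitrary: T P C0 D0 rule: finite_induct)
  case empty
  let ?R = "V - T"
  have "{(C, D) \<in> dominating_pairs g h V. P C D}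
      \<subseteq> {(C, D) \<in> dominating_pairs g h V. C - ?R = C0 \<and> D - ?R = D0}"
  proof clarify
    fix C D assume *: "(C, D) \<in> dominating_pairs g h V" "P C D"
    then have "C \<subseteq> V" "D \<subseteq> V" by (auto simp: dominating_pairs_def indep_pairs_def)
    moreover have "C \<inter> T = C0" "D \<inter> T = D0" using empty(5)[OF *] by auto
    ultimately show "C - (V - T) = C0 \<and> D - (V - T) = D0" by blast
  qed
  then have "card {(C, D) \<in> dominating_pairs g h V. P C D}
      \<le> card {(C, D) \<in> dominating_pairs g h V. C - ?R = C0 \<and> D - ?R = D0}"
    by (rule card_mono[OF finite_cnt])
  also have "\<dots> \<le> card (dominating_pairs g h ?R)"
    by (rule card_dominating_pairs_restrict) (use finite_V in auto)
  finally have "cnt P \<le> card (dominating_pairs g h ?R)" by (simp add: cnt_def)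
  also have "\<dots> \<le> facet_bound (int (card ?R))" by (rule IH) (use empty in auto)
  also have "int (card ?R) = d - card T"
    using empty finite_V by (simp add: card_Diff_subset finite_subset card_mono of_nat_diff)
  finally show ?case by simp
next
  case (insert s S)
  have sV: "s \<in> V" "s \<notin> T" "finite T"
    using insert.prems finite_subset[OF _ finite_V] by auto
  have half: "cnt P' \<le> 2 ^ card S * facet_bound (d - int (card (insert s T) + card S))"
    if P': "\<And>C D. P' C D \<Longrightarrow> P C D"
      and CD: "\<And>C D. (C, D) \<in> dominating_pairs g h V \<Longrightarrow> P' C D \<Longrightarrow> s \<in> C \<longleftrightarrow> b"
        "\<And>C D. (C, D) \<in> dominating_pairs g h V \<Longrightarrow> P' C D \<Longrightarrow> s \<in> D \<longleftrightarrow> c"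
    for P' b c
  proof (rule insert.IH)
    show "insert s T \<subseteq> V" "S \<subseteq> V" "insert s T \<inter> S = {}" "insert s T \<noteq> {}"
      using insert.prems insert.hyps by auto
    show "C \<inter> insert s T = (if b then insert s C0 else C0) \<and> D \<inter> insert s T = (if c then insert s D0 else D0)"
      if "(C, D) \<in> dominating_pairs g h V" "P' C D" for C D
      using insert.prems(5)[OF that(1) P'[OF that(2)]] CD[OF that] by auto
    show "(\<forall>C D. (C, D) \<in> dominating_pairs g h V \<longrightarrow> P' C D \<longrightarrow> t \<notin> C) \<or>
        (\<forall>C D. (C, D) \<in> dominating_pairs g h V \<longrightarrow> P' C D \<longrightarrow> t \<notin> D)" if "t \<in> S" for t
      using insert.prems(6)[of t] that P' by blast
  qed
  have "cnt P \<le> 2 ^ card S * facet_bound (d - int (card (insert s T) + card S))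
      + 2 ^ card S * facet_bound (d - int (card (insert s T) + card S))"
  proof (cases "\<forall>C D. (C, D) \<in> dominating_pairs g h V \<longrightarrow> P C D \<longrightarrow> s \<notin> C")
    case True
    have "cnt P \<le> cnt (\<lambda>C D. P C D \<and> s \<in> D) + cnt (\<lambda>C D. P C D \<and> s \<notin> D)"
      by (rule cnt_le_2) auto
    moreover have "cnt (\<lambda>C D. P C D \<and> s \<in> D) \<le> 2 ^ card S * facet_bound (d - int (card (insert s T) + card S))"
      by (rule half[where b=False and c=True]) (use True in auto)
    moreover have "cnt (\<lambda>C D. P C D \<and> s \<notin> D) \<le> 2 ^ card S * facet_bound (d - int (card (insert s T) + card S))"
      by (rule half[where b=False and c=False]) (use True in auto)
    ultimately show ?thesis by linarith
  next
    case False
    then have s: "\<forall>C D. (C, D) \<in> dominating_pairs g h V \<longrightarrow> P C D \<longrightarrow> s \<notin> D"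
      using insert.prems(6) by blast
    have "cnt P \<le> cnt (\<lambda>C D. P C D \<and> s \<in> C) + cnt (\<lambda>C D. P C D \<and> s \<notin> C)"
      by (rule cnt_le_2) auto
    moreover have "cnt (\<lambda>C D. P C D \<and> s \<in> C) \<le> 2 ^ card S * facet_bound (d - int (card (insert s T) + card S))"
      by (rule half[where b=True and c=False]) (use s in auto)
    moreover have "cnt (\<lambda>C D. P C D \<and> s \<notin> C) \<le> 2 ^ card S * facet_bound (d - int (card (insert s T) + card S))"
      by (rule half[where b=False and c=False]) (use s in auto)
    ultimately show ?thesis by linarith
  qed
  then show ?case using sV insert.hyps by (simp add: algebra_simps)
qed

lemma swap: "induction_step h g V"
  using two_graphs_axioms finite_V IH card_dominating_pairs_swap[of h g]
  by (auto simp: induction_step_def induction_step_axioms_def two_graphs_swap)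

text \<open>A vertex in \<open>C\<close> bars its \<open>g\<close>-neighbours from \<open>C\<close>,
  which leaves them two states each. Only \<open>j\<close> of them are exploited, so a lower bound
  on the degree is enough.\<close>

lemma cnt_C:
  assumes "v \<in> V" "j \<le> card (Ng v)"
  shows "cnt (\<lambda>C D. v \<in> C) \<le> 2 ^ j * facet_bound (d - int (1 + j))"
proof -
  obtain S where S: "S \<subseteq> Ng v" "card S = j" "finite S"
    using obtain_subset_with_card_n[OF assms(2)] by blast
  have "cnt (\<lambda>C D. v \<in> C) \<le> 2 ^ card S * facet_bound (d - int (card {v} + card S))"
  proof (rule cnt_pattern[where ?C0.0="{v}" and ?D0.0="{}"])
    show "S \<subseteq> V" "{v} \<inter> S = {}" using S N_V(1)[of _ v] N_irrefl(1)[of v] by blast+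
    show "\<And>C D. (C, D) \<in> dominating_pairs g h V \<Longrightarrow> v \<in> C \<Longrightarrow> C \<inter> {v} = {v} \<and> D \<inter> {v} = {}"
      using pairD(1) by blast
    show "(\<forall>C D. (C, D) \<in> dominating_pairs g h V \<longrightarrow> v \<in> C \<longrightarrow> s \<notin> C) \<or>
        (\<forall>C D. (C, D) \<in> dominating_pairs g h V \<longrightarrow> v \<in> C \<longrightarrow> s \<notin> D)" if "s \<in> S" for s
      using that S(1) pairD(3)[of _ _ v s] by blast
  qed (use S assms in auto)
  then show ?thesis using S by simp
qed

lemma cnt_D:
  assumes "v \<in> V" "j \<le> card (Nh v)"
  shows "cnt (\<lambda>C D. v \<in> D) \<le> 2 ^ j * facet_bound (d - int (1 + j))"
proof -
  obtain S where S: "S \<subseteq> Nh v" "card S = j" "finite S"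
    using obtain_subset_with_card_n[OF assms(2)] by blast
  have "cnt (\<lambda>C D. v \<in> D) \<le> 2 ^ card S * facet_bound (d - int (card {v} + card S))"
  proof (rule cnt_pattern[where ?C0.0="{}" and ?D0.0="{v}"])
    show "S \<subseteq> V" "{v} \<inter> S = {}" using S N_V(2)[of _ v] N_irrefl(2)[of v] by blast+
    show "\<And>C D. (C, D) \<in> dominating_pairs g h V \<Longrightarrow> v \<in> D \<Longrightarrow> C \<inter> {v} = {} \<and> D \<inter> {v} = {v}"
      using pairD(2) by blast
    show "(\<forall>C D. (C, D) \<in> dominating_pairs g h V \<longrightarrow> v \<in> D \<longrightarrow> s \<notin> C) \<or>
        (\<forall>C D. (C, D) \<in> dominating_pairs g h V \<longrightarrow> v \<in> D \<longrightarrow> s \<notin> D)" if "s \<in> S" for s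
      using that S(1) pairD(4)[of _ _ v s] by blast
  qed (use S assms in auto)
  then show ?thesis using S by simp
qed

lemma cnt_none:
  assumes "v \<in> V"
  shows "cnt (\<lambda>C D. v \<notin> C \<and> v \<notin> D) \<le> facet_bound (d - 1)"
  using cnt_pattern[of "{}" "{v}" "\<lambda>C D. v \<notin> C \<and> v \<notin> D" "{}" "{}"] assms by auto

lemma total_le_degrees:
  assumes "v \<in> V" "i \<le> card (Ng v)" "j \<le> card (Nh v)"
  shows "total \<le> 2 ^ i * facet_bound (d - int (1 + i)) + 2 ^ j * facet_bound (d - int (1 + j))
    + cnt (\<lambda>C D. v \<notin> C \<and> v \<notin> D)"
  using total_le[of v] cnt_C[OF assms(1,2)] cnt_D[OF assms(1,3)] by linarith

lemma cnt_none_C: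
  assumes "v \<in> V" "u \<in> V" "u \<noteq> v" "S \<subseteq> V" "u \<notin> S" "v \<notin> S"
    and "\<And>C D. P C D \<Longrightarrow> v \<notin> C \<and> v \<notin> D \<and> u \<in> C"
    and "\<And>s. s \<in> S \<Longrightarrow> s \<in> Ng u \<or> (\<forall>C D. P C D \<longrightarrow> s \<notin> C) \<or> (\<forall>C D. P C D \<longrightarrow> s \<notin> D)"
  shows "cnt P \<le> 2 ^ card S * facet_bound (d - int (2 + card S))"
proof -
  have "cnt P \<le> 2 ^ card S * facet_bound (d - int (card {v, u} + card S))"
  proof (rule cnt_pattern[where ?C0.0="{u}" and ?D0.0="{}"])
    show "finite S" using assms finite_V finite_subset by blast
    show "\<And>C D. (C, D) \<in> dominating_pairs g h V \<Longrightarrow> P C D \<Longrightarrow> C \<inter> {v, u} = {u} \<and> D \<inter> {v, u} = {}"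
      using assms(7) pairD(1) by blast
    show "(\<forall>C D. (C, D) \<in> dominating_pairs g h V \<longrightarrow> P C D \<longrightarrow> s \<notin> C) \<or>
        (\<forall>C D. (C, D) \<in> dominating_pairs g h V \<longrightarrow> P C D \<longrightarrow> s \<notin> D)" if "s \<in> S" for s
      using assms(8)[OF that] assms(7) pairD(3) by blast
  qed (use assms in auto)
  then show ?thesis using assms by simp
qed

lemma cnt_none_D:
  assumes "v \<in> V" "u \<in> V" "u \<noteq> v" "S \<subseteq> V" "u \<notin> S" "v \<notin> S"
    and "\<And>C D. P C D \<Longrightarrow> v \<notin> C \<and> v \<notin> D \<and> u \<in> D"
    and "\<And>s. s \<in> S \<Longrightarrow> s \<in> Nh u \<or> (\<forall>C D. P C D \<longrightarrow> s \<notin> C) \<or> (\<forall>C D. P C D \<longrightarrow> s \<notin> D)"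
  shows "cnt P \<le> 2 ^ card S * facet_bound (d - int (2 + card S))"
proof -
  have "cnt P \<le> 2 ^ card S * facet_bound (d - int (card {v, u} + card S))"
  proof (rule cnt_pattern[where ?C0.0="{}" and ?D0.0="{u}"])
    show "finite S" using assms finite_V finite_subset by blast
    show "\<And>C D. (C, D) \<in> dominating_pairs g h V \<Longrightarrow> P C D \<Longrightarrow> C \<inter> {v, u} = {} \<and> D \<inter> {v, u} = {u}"
      using assms(7) pairD(2) by blast
    show "(\<forall>C D. (C, D) \<in> dominating_pairs g h V \<longrightarrow> P C D \<longrightarrow> s \<notin> C) \<or>
        (\<forall>C D. (C, D) \<in> dominating_pairs g h V \<longrightarrow> P C D \<longrightarrow> s \<notin> D)" if "s \<in> S" for s
      using assms(8)[OF that] assms(7) pairD(4) by blast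
  qed (use assms in auto)
  then show ?thesis using assms by simp
qed

text \<open>The strict inequality reflects that \<open>v\<close> is itself an
  \<open>h\<close>-neighbour of \<open>u\<close> whose status is already prescribed.\<close>

lemma cnt_none_D_degree:
  assumes "v \<in> V" "u \<in> Nh v" "j < card (Nh u)"
  shows "cnt (\<lambda>C D. (v \<notin> C \<and> v \<notin> D) \<and> u \<in> D) \<le> 2 ^ j * facet_bound (d - int (2 + j))"
proof -
  have "v \<in> Nh u" "u \<in> V" "u \<noteq> v" using assms N_sym N_V N_irrefl by blast+
  then have "j \<le> card (Nh u - {v})" using assms by simp
  then obtain S where S: "S \<subseteq> Nh u - {v}" "card S = j"
    using obtain_subset_with_card_n by metis
  have "cnt (\<lambda>C D. (v \<notin> C \<and> v \<notin> D) \<and> u \<in> D) \<le> 2 ^ card S * facet_bound (d - int (2 + card S))"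
  proof (rule cnt_none_D[of v u])
    show "S \<subseteq> V" "u \<notin> S" "v \<notin> S" using S(1) N_V(2)[of _ u] N_irrefl(2)[of u] by blast+
  qed (use S(1) \<open>u \<in> V\<close> \<open>u \<noteq> v\<close> assms(1) in auto)
  then show ?thesis using S by simp
qed

section \<open>Vertices of degree at most one in both graphs\<close>

lemma total_00:
  assumes "v \<in> V" "Ng v = {}" "Nh v = {}"
  shows "total \<le> 2 * facet_bound (d - 1)"
proof -
  have "cnt (\<lambda>C D. v \<notin> C \<and> v \<notin> D) \<le> (\<Sum>i\<in>{}. cnt i)"
    by (rule cnt_le) (auto dest!: dominated[OF _ assms(1-3)])
  then show ?thesis using total_le_degrees[OF assms(1), of 0 0] by simp
qed

lemma total_01:
  assumes "v \<in> V" "Ng v = {}" "Nh v = {u}"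
  shows "total \<le> facet_bound (d - 1) + 3 * facet_bound (d - 2)"
proof -
  have "u \<in> V" "u \<noteq> v" using assms N_V N_irrefl by blast+
  have "cnt (\<lambda>C D. v \<notin> C \<and> v \<notin> D) \<le> (\<Sum>i\<in>{u}. cnt (\<lambda>C D. (v \<notin> C \<and> v \<notin> D) \<and> i \<in> D))"
    by (rule cnt_le) (auto dest!: dominated[OF _ assms(1-3)])
  also have "\<dots> \<le> facet_bound (d - 2)"
    using cnt_none_D[of v u "{}" "\<lambda>C D. (v \<notin> C \<and> v \<notin> D) \<and> u \<in> D"] assms \<open>u \<in> V\<close> \<open>u \<noteq> v\<close> by simp
  finally show ?thesis using total_le_degrees[OF assms(1), of 0 1] assms by simp
qed

lemma cnt_none_11:
  assumes "v \<in> V" "Ng v = {u}" "Nh v = {w}"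
  shows "cnt (\<lambda>C D. v \<notin> C \<and> v \<notin> D) \<le> 2 * facet_bound (d - 2)"
    and "u \<noteq> w \<Longrightarrow> cnt (\<lambda>C D. v \<notin> C \<and> v \<notin> D) \<le> facet_bound (d - 2) + 2 * facet_bound (d - 3)"
proof -
  have uw: "u \<in> V" "u \<noteq> v" "w \<in> V" "w \<noteq> v" using assms N_V N_irrefl by blast+
  let ?C = "\<lambda>C D. (v \<notin> C \<and> v \<notin> D) \<and> u \<in> C" and ?D = "\<lambda>C D. (v \<notin> C \<and> v \<notin> D) \<and> w \<in> D \<and> u \<notin> C"
  have *: "cnt (\<lambda>C D. v \<notin> C \<and> v \<notin> D) \<le> cnt ?C + cnt ?D"
    by (rule cnt_le_2) (auto dest!: dominated[OF _ assms(1-3)])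
  have C: "cnt ?C \<le> facet_bound (d - 2)"
    using cnt_none_C[of v u "{}" ?C] assms uw by simp
  show "cnt (\<lambda>C D. v \<notin> C \<and> v \<notin> D) \<le> 2 * facet_bound (d - 2)"
    using * C cnt_none_D[of v w "{}" ?D] assms uw by simp
  show "cnt (\<lambda>C D. v \<notin> C \<and> v \<notin> D) \<le> facet_bound (d - 2) + 2 * facet_bound (d - 3)" if "u \<noteq> w"
    using * C cnt_none_D[of v w "{u}" ?D] assms uw that by simp
qed

text \<open>The sharp configuration: the three states of \<open>v\<close> contribute two copies of
  \<open>facet_bound (d - 2)\<close> each, six in all, whatever the parity.\<close>

lemma total_11:
  assumes "v \<in> V" "Ng v = {u}" "Nh v = {w}"
  shows "total \<le> facet_bound d"
  using total_le_degrees[OF assms(1), of 1 1] cnt_none_11[OF assms] facet_bound_minus_2[of d] assms by simp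

section \<open>Strict bounds for an even number of vertices\<close>

lemma even_12:
  assumes "even d" "v \<in> V" "1 \<le> card (Ng v)" "2 \<le> card (Nh v)"
  shows "total < facet_bound d"
  using total_le_degrees[OF assms(2-4)] cnt_none[OF assms(2)] facet_bound_even[OF assms(1)] facet_bound_pos[of d]
  by simp

lemma even_11:
  assumes "even d" "v \<in> V" "card (Ng v) = 1" "card (Nh v) = 1" "Ng v \<noteq> Nh v"
  shows "total < facet_bound d"
proof -
  obtain u w where uw: "Ng v = {u}" "Nh v = {w}" using assms by (metis card_1_singletonE)
  then show ?thesis
    using cnt_none_11(2)[OF assms(2) uw] total_le_degrees[of v 1 1] assms
      facet_bound_even[OF assms(1)] facet_bound_pos[of d] by simp
qed

lemma even_0_le2:
  assumes "even d" "v \<in> V" "Ng v = {}" "card (Nh v) \<le> 2"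
  shows "total < facet_bound d"
proof -
  consider "card (Nh v) = 0" | "card (Nh v) = 1" | "card (Nh v) = 2" using assms(4) by linarith
  then show ?thesis
  proof cases
    case 1
    then have "Nh v = {}" by simp
    then show ?thesis
      using total_00[OF assms(2,3)] facet_bound_even[OF assms(1)] facet_bound_pos[of d] by simp
  next
    case 2
    then obtain u where "Nh v = {u}" by (metis card_1_singletonE)
    then show ?thesis
      using total_01[OF assms(2,3)] facet_bound_even[OF assms(1)] facet_bound_pos[of d] by simp
  next
    case 3
    have "cnt (\<lambda>C D. v \<notin> C \<and> v \<notin> D) \<le> (\<Sum>i\<in>Nh v. cnt (\<lambda>C D. (v \<notin> C \<and> v \<notin> D) \<and> i \<in> D))"
    proof (rule cnt_le)
      show "\<exists>u\<in>Nh v. (v \<notin> C \<and> v \<notin> D) \<and> u \<in> D" if "(C, D) \<in> dominating_pairs g h V" "v \<notin> C \<and> v \<notin> D" for C D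
        using dominated[OF that(1) assms(2,3) refl] that(2) by blast
    qed simp
    also have "\<dots> \<le> (\<Sum>i\<in>Nh v. facet_bound (d - 2))"
    proof (rule sum_mono)
      fix u assume u: "u \<in> Nh v"
      then have "v \<in> Nh u" using assms N_sym by blast
      then have "0 < card (Nh u)" by (auto simp: card_gt_0_iff)
      then show "cnt (\<lambda>C D. (v \<notin> C \<and> v \<notin> D) \<and> u \<in> D) \<le> facet_bound (d - 2)"
        using cnt_none_D_degree[OF assms(2) u, of 0] by simp
    qed
    finally show ?thesis
      using total_le_degrees[of v 0 2] 3 assms facet_bound_even[OF assms(1)] facet_bound_pos[of d] by simp
  qed
qed

lemma even_0_ge4:
  assumes "even d" "v \<in> V" "4 \<le> card (Nh v)"
  shows "total < facet_bound d"
  using total_le_degrees[OF assms(2) _ assms(3), of 0] cnt_none[OF assms(2)]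
    facet_bound_even[OF assms(1)] facet_bound_pos[of d] by simp

text \<open>Degree three is the delicate degree of a vertex isolated in \<open>g\<close>: bounding
  each of the three dominating branches by \<open>facet_bound (d - 2)\<close> is too weak. A further
  neighbour of \<open>a\<close> and of \<open>b\<close>, and the absence of \<open>a\<close> and
  \<open>b\<close> from \<open>D\<close> in the last branch, bring the total down to
  \<open>53 / 54\<close> of the bound.\<close>

lemma even_03:
  assumes "even d" "v \<in> V" "Ng v = {}" "card (Nh v) = 3" "\<And>u. u \<in> Nh v \<Longrightarrow> 2 \<le> card (Nh u)"
  shows "total < facet_bound d"
proof -
  obtain a b c where abc: "Nh v = {a, b, c}" "a \<noteq> b" "a \<noteq> c" "b \<noteq> c"
    using assms(4) by (auto simp: card_3_iff)
  have V: "a \<in> V" "b \<in> V" "c \<in> V" "a \<noteq> v" "b \<noteq> v" "c \<noteq> v"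
    using abc(1) N_V(2)[of _ v] N_irrefl(2)[of v] by auto
  let ?P = "\<lambda>x C D. (v \<notin> C \<and> v \<notin> D) \<and> x \<in> D" and ?Q = "\<lambda>C D. (v \<notin> C \<and> v \<notin> D) \<and> c \<in> D \<and> a \<notin> D \<and> b \<notin> D"
  have "cnt (\<lambda>C D. v \<notin> C \<and> v \<notin> D) \<le> cnt (?P a) + cnt (?P b) + cnt ?Q"
    by (rule cnt_le_3) (auto dest!: dominated[OF _ assms(2,3) abc(1)])
  moreover have "cnt (?P x) \<le> 2 * facet_bound (d - 3)" if "x \<in> Nh v" for x
    using cnt_none_D_degree[OF assms(2) that, of 1] assms(5)[OF that] by simp
  from this[of a] this[of b] have "cnt (?P a) \<le> 2 * facet_bound (d - 3)" "cnt (?P b) \<le> 2 * facet_bound (d - 3)"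
    using abc by simp_all
  moreover have "cnt ?Q \<le> 4 * facet_bound (d - 4)"
    using cnt_none_D[of v c "{a, b}" ?Q] V abc assms by auto
  ultimately show ?thesis
    using total_le_degrees[of v 0 3] assms facet_bound_even[OF assms(1)] facet_bound_pos[of d] by simp
qed

lemma total_swap: "real (card (dominating_pairs h g V)) = total"
  by (simp add: card_dominating_pairs_swap[of h g])

lemma even_nonisolated:
  assumes "even d" "v \<in> V" "Ng v \<noteq> {}" "Nh v \<noteq> {}" "\<not> (\<exists>u. Ng v = {u} \<and> Nh v = {u})"
  shows "total < facet_bound d"
proof -
  interpret sw: induction_step h g V by (rule swap)
  have "card (Ng v) \<ge> 1" "card (Nh v) \<ge> 1" using assms by (simp_all add: Suc_le_eq card_gt_0_iff)
  then consider "2 \<le> card (Nh v)" | "2 \<le> card (Ng v)" | "card (Ng v) = 1" "card (Nh v) = 1" by linarith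
  then show ?thesis
  proof cases
    case 1 then show ?thesis using even_12[OF assms(1,2) \<open>card (Ng v) \<ge> 1\<close>] by simp
  next
    case 2 then show ?thesis using sw.even_12[OF assms(1,2) \<open>card (Nh v) \<ge> 1\<close>] total_swap by simp
  next
    case 3
    then have "Ng v \<noteq> Nh v" using assms(5) by (metis card_1_singletonE)
    then show ?thesis using even_11[OF assms(1,2) 3] by simp
  qed
qed

text \<open>In degree three, a neighbour \<open>u\<close> whose only \<open>h\<close>-neighbour is
  \<open>v\<close> is used as the branching vertex instead. It is either isolated in
  \<open>g\<close> with small \<open>h\<close>-degree, or has neighbours in both graphs but not a
  common single one, since \<open>v\<close> is not a \<open>g\<close>-neighbour of
  \<open>u\<close>.\<close>

lemma even_isolated:
  assumes "even d" "v \<in> V" "Ng v = {}"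
  shows "total < facet_bound d"
proof -
  consider "card (Nh v) \<le> 2" | "card (Nh v) \<ge> 4" | "card (Nh v) = 3" by linarith
  then show ?thesis
  proof cases
    case 1 then show ?thesis by (rule even_0_le2[OF assms])
  next
    case 2 then show ?thesis by (rule even_0_ge4[OF assms(1,2)])
  next
    case 3
    show ?thesis
    proof (cases "\<forall>u\<in>Nh v. 2 \<le> card (Nh u)")
      case True then show ?thesis using even_03[OF assms 3] by blast
    next
      case False
      then obtain u where u: "u \<in> Nh v" "card (Nh u) < 2" by force
      then have uv: "v \<in> Nh u" "u \<in> V" using assms N_sym N_V by blast+
      show ?thesis
      proof (cases "Ng u = {}")
        case True then show ?thesis using even_0_le2[OF assms(1) uv(2)] u by simp
      next
        case F: False
        have "v \<notin> Ng u" using assms N_sym uv by blast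
        then have "\<not> (\<exists>x. Ng u = {x} \<and> Nh u = {x})" using uv by auto
        then show ?thesis using even_nonisolated[OF assms(1) uv(2) F] uv by blast
      qed
    qed
  qed
qed

lemma even_case:
  assumes "even d" "v \<in> V" "\<not> (\<exists>u. Ng v = {u} \<and> Nh v = {u})"
  shows "total < facet_bound d"
proof -
  interpret sw: induction_step h g V by (rule swap)
  consider "Ng v = {}" | "Nh v = {}" | "Ng v \<noteq> {}" "Nh v \<noteq> {}" by blast
  then show ?thesis
  proof cases
    case 1 then show ?thesis by (rule even_isolated[OF assms(1,2)])
  next
    case 2 then show ?thesis using sw.even_isolated[OF assms(1,2)] total_swap by simp
  next
    case 3 then show ?thesis by (rule even_nonisolated[OF assms(1,2) _ _ assms(3)])
  qed
qed

section \<open>Configurations that give the bound for an odd number of vertices\<close>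

lemma odd_22:
  assumes "odd d" "v \<in> V" "2 \<le> card (Ng v)" "2 \<le> card (Nh v)"
  shows "total \<le> facet_bound d"
  using total_le_degrees[OF assms(2-4)] cnt_none[OF assms(2)] facet_bound_odd[OF assms(1)] facet_bound_pos[of d]
  by simp

lemma odd_13:
  assumes "odd d" "v \<in> V" "1 \<le> card (Ng v)" "3 \<le> card (Nh v)"
  shows "total \<le> facet_bound d"
  using total_le_degrees[OF assms(2-4)] cnt_none[OF assms(2)] facet_bound_odd[OF assms(1)] facet_bound_pos[of d]
  by simp

lemma odd_0_le1:
  assumes "odd d" "v \<in> V" "Ng v = {}" "card (Nh v) \<le> 1"
  shows "total \<le> facet_bound d"
proof (cases "Nh v = {}")
  case True
  then show ?thesis
    using total_00[OF assms(2,3)] facet_bound_odd[OF assms(1)] facet_bound_pos[of d] by simp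
next
  case False
  then have "card (Nh v) = 1" using assms(4) by (simp add: le_Suc_eq)
  then obtain u where "Nh v = {u}" by (metis card_1_singletonE)
  then show ?thesis
    using total_01[OF assms(2,3)] facet_bound_odd[OF assms(1)] facet_bound_pos[of d] by simp
qed

lemma odd_0_ge6:
  assumes "odd d" "v \<in> V" "6 \<le> card (Nh v)"
  shows "total \<le> facet_bound d"
  using total_le_degrees[OF assms(2) _ assms(3), of 0] cnt_none[OF assms(2)]
    facet_bound_odd[OF assms(1)] facet_bound_pos[of d] by simp

text \<open>The estimate is tight: the branches contribute \<open>3 / 7\<close>,
  \<open>2 / 7\<close> and twice \<open>1 / 7\<close> of the bound. The second neighbour of
  \<open>a\<close> is what lowers its branch from \<open>1 / 6\<close> to
  \<open>1 / 7\<close>.\<close>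

lemma odd_02_nonleaf:
  assumes "odd d" "v \<in> V" "Ng v = {}" "Nh v = {a, b}" "a \<noteq> b" "2 \<le> card (Nh a)"
  shows "total \<le> facet_bound d"
proof -
  have V: "a \<in> V" "b \<in> V" "a \<noteq> v" "b \<noteq> v"
    using assms(4) N_V(2)[of _ v] N_irrefl(2)[of v] by auto
  let ?P = "\<lambda>C D. (v \<notin> C \<and> v \<notin> D) \<and> a \<in> D" and ?Q = "\<lambda>C D. (v \<notin> C \<and> v \<notin> D) \<and> b \<in> D \<and> a \<notin> D"
  have "cnt (\<lambda>C D. v \<notin> C \<and> v \<notin> D) \<le> cnt ?P + cnt ?Q"
    by (rule cnt_le_2) (auto dest!: dominated[OF _ assms(2-4)])
  moreover have "cnt ?P \<le> 2 * facet_bound (d - 3)"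
    using cnt_none_D_degree[OF assms(2), of a 1] assms by simp
  moreover have "cnt ?Q \<le> 2 * facet_bound (d - 3)"
    using cnt_none_D[of v b "{a}" ?Q] V assms by simp
  ultimately show ?thesis
    using total_le_degrees[of v 0 2] assms facet_bound_odd[OF assms(1)] facet_bound_pos[of d] by simp
qed

lemma odd_02_leaf:
  assumes "odd d" "v \<in> V" "Ng v = {}" "Nh v = {a, b}" "a \<noteq> b" "Nh a = {v}" "card (Ng a) = 2"
  shows "total \<le> facet_bound d"
proof -
  have V: "a \<in> V" "b \<in> V" "a \<noteq> v" "b \<noteq> v"
    using assms(4) N_V(2)[of _ v] N_irrefl(2)[of v] by auto
  have va: "v \<notin> Ng a" "a \<notin> Ng a" using N_sym(1)[of v a] V assms(3) N_irrefl by auto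
  let ?P = "\<lambda>C D. (v \<notin> C \<and> v \<notin> D) \<and> a \<in> D"
    and ?Q = "\<lambda>C D. (v \<notin> C \<and> v \<notin> D) \<and> a \<in> C \<and> b \<in> D"
    and ?R = "\<lambda>C D. (v \<notin> C \<and> v \<notin> D) \<and> (a \<notin> C \<and> a \<notin> D) \<and> b \<in> D"
  have "cnt (\<lambda>C D. v \<notin> C \<and> v \<notin> D) \<le> cnt ?P + cnt ?Q + cnt ?R"
    by (rule cnt_le_3) (auto dest!: dominated[OF _ assms(2-4)])
  moreover have "cnt ?P \<le> facet_bound (d - 2)"
    using cnt_none_D_degree[OF assms(2), of a 0] assms by simp
  moreover have "cnt ?Q \<le> 2 * facet_bound (d - 4)"
  proof -
    have "card (Ng a - {b}) > 0" using assms(7) by (simp add: card_Diff_singleton_if)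
    then obtain w where w: "w \<in> Ng a" "w \<noteq> b" by (auto simp: card_gt_0_iff)
    have "cnt ?Q \<le> 2 ^ card {w} * facet_bound (d - int (card {v, a, b} + card {w}))"
    proof (rule cnt_pattern[where ?C0.0="{a}" and ?D0.0="{b}"])
      show "{v, a, b} \<inter> {w} = {}" using w va by auto
      show "\<And>C D. (C, D) \<in> dominating_pairs g h V \<Longrightarrow> ?Q C D \<Longrightarrow> C \<inter> {v, a, b} = {a} \<and> D \<inter> {v, a, b} = {b}"
        using pairD(1,2) by blast
      show "(\<forall>C D. (C, D) \<in> dominating_pairs g h V \<longrightarrow> ?Q C D \<longrightarrow> s \<notin> C) \<or>
        (\<forall>C D. (C, D) \<in> dominating_pairs g h V \<longrightarrow> ?Q C D \<longrightarrow> s \<notin> D)" if "s \<in> {w}" for s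
        using that w(1) pairD(3)[of _ _ a w] by blast
    qed (use w V assms N_V in auto)
    then show ?thesis using assms V by simp
  qed
  moreover have "cnt ?R \<le> 2 * facet_bound (d - 4)"
  proof -
    have "cnt ?R \<le> (\<Sum>w\<in>Ng a - {b}. cnt (\<lambda>C D. ?R C D \<and> w \<in> C))"
    proof (rule cnt_le)
      show "\<exists>w\<in>Ng a - {b}. ?R C D \<and> w \<in> C" if "(C, D) \<in> dominating_pairs g h V" "?R C D" for C D
        using dominated[OF that(1) V(1) refl assms(6)] that(2) pairD(2)[OF that(1), of b] by blast
    qed simp
    also have "\<dots> \<le> (\<Sum>w\<in>Ng a - {b}. facet_bound (d - 4))"
    proof (rule sum_mono)
      fix w assume w: "w \<in> Ng a - {b}"
      have "cnt (\<lambda>C D. ?R C D \<and> w \<in> C) \<le> 2 ^ card ({} :: 'v set) * facet_bound (d - int (card {v, a, b, w} + card ({} :: 'v set)))"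
      proof (rule cnt_pattern[where ?C0.0="{w}" and ?D0.0="{b}"])
        show "{v, a, b, w} \<subseteq> V" using w V assms N_V by auto
        show "\<And>C D. (C, D) \<in> dominating_pairs g h V \<Longrightarrow> ?R C D \<and> w \<in> C \<Longrightarrow>
            C \<inter> {v, a, b, w} = {w} \<and> D \<inter> {v, a, b, w} = {b}"
          using pairD(1,2) by blast
      qed auto
      moreover have "w \<noteq> v" "w \<noteq> a" "w \<noteq> b" using w va by auto
      then have "card {v, a, b, w} = 4" using V assms(5) by (simp add: eq_commute[of _ w] eq_commute[of v])
      ultimately show "cnt (\<lambda>C D. ?R C D \<and> w \<in> C) \<le> facet_bound (d - 4)" by simp
    qed
    also have "\<dots> \<le> 2 * facet_bound (d - 4)"
    proof -
      have "card (Ng a - {b}) \<le> 2" using assms(7) by (simp add: card_Diff_singleton_if)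
      then show ?thesis using facet_bound_pos[of "d - 4"] by simp
    qed
    finally show ?thesis .
  qed
  ultimately show ?thesis
    using total_le_degrees[of v 0 2] assms facet_bound_odd[OF assms(1)] facet_bound_pos[of d] by simp
qed

lemma odd_02:
  assumes "odd d" "v \<in> V" "Ng v = {}" "card (Nh v) = 2"
    and "\<And>u. u \<in> V \<Longrightarrow> card (Nh u) = 1 \<Longrightarrow> card (Ng u) = 2"
  shows "total \<le> facet_bound d"
proof -
  obtain a b where ab: "Nh v = {a, b}" "a \<noteq> b" using assms(4) by (auto simp: card_2_iff)
  have a: "a \<in> V" "v \<in> Nh a" using ab(1) N_V(2)[of a v] N_sym(2)[of a v] assms(2) by auto
  show ?thesis
  proof (cases "2 \<le> card (Nh a)")
    case True then show ?thesis using odd_02_nonleaf[OF assms(1-3) ab] by simp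
  next
    case False
    moreover have "card (Nh a) > 0" using a by (auto simp: card_gt_0_iff)
    ultimately have 1: "card (Nh a) = 1" by linarith
    then have "Nh a = {v}" using a by (metis card_1_singletonE singletonD)
    then show ?thesis using odd_02_leaf[OF assms(1-3) ab] assms(5)[OF a(1) 1] by simp
  qed
qed

lemma odd_0_minimal:
  assumes "odd d" "v \<in> V" "Ng v = {}" "3 \<le> card (Nh v)" "\<And>u. u \<in> Nh v \<Longrightarrow> card (Nh v) \<le> card (Nh u)"
  shows "total \<le> facet_bound d"
proof -
  obtain l where l: "card (Nh v) = Suc l" using assms(4) by (cases "card (Nh v)") auto
  have "cnt (\<lambda>C D. v \<notin> C \<and> v \<notin> D) \<le> (\<Sum>u\<in>Nh v. cnt (\<lambda>C D. (v \<notin> C \<and> v \<notin> D) \<and> u \<in> D))"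
  proof (rule cnt_le)
    show "\<exists>u\<in>Nh v. (v \<notin> C \<and> v \<notin> D) \<and> u \<in> D" if "(C, D) \<in> dominating_pairs g h V" "v \<notin> C \<and> v \<notin> D" for C D
      using dominated[OF that(1) assms(2,3) refl] that(2) by blast
  qed simp
  also have "\<dots> \<le> (\<Sum>u\<in>Nh v. 2 ^ l * facet_bound (d - int (2 + l)))"
    by (rule sum_mono) (use cnt_none_D_degree[OF assms(2), of _ l] assms(5) l in fastforce)
  also have "\<dots> = (l + 1) * (2 ^ l * facet_bound (d - int (2 + l)))" using l by simp
  finally have N: "cnt (\<lambda>C D. v \<notin> C \<and> v \<notin> D) \<le> (l + 1) * (2 ^ l * facet_bound (d - int (2 + l)))" .
  consider "6 \<le> card (Nh v)" | "l = 2" | "l = 3" | "l = 4" using assms(4) l by linarith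
  then show ?thesis
  proof cases
    case 1 then show ?thesis by (rule odd_0_ge6[OF assms(1,2)])
  qed (use N total_le_degrees[of v 0 "Suc l"] l assms facet_bound_odd[OF assms(1)] facet_bound_pos[of d] in simp_all)
qed

text \<open>Here the branching vertex is a neighbour \<open>u\<close> of the isolated vertex
  \<open>v\<close>. As \<open>v\<close> has at least two further \<open>h\<close>-neighbours, the
  branch with \<open>v\<close> in \<open>D\<close> is cheap, and in the other branches
  \<open>v\<close> has two states left.\<close>

lemma odd_21_nbr:
  assumes "odd d" "u \<in> V" "card (Ng u) = 2" "Nh u = {v}" "Ng v = {}" "3 \<le> card (Nh v)"
  shows "total \<le> facet_bound d"
proof -
  obtain a b where ab: "Ng u = {a, b}" "a \<noteq> b" using assms(3) by (auto simp: card_2_iff)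
  have V: "a \<in> V" "b \<in> V" "a \<noteq> u" "b \<noteq> u" "v \<in> V" "v \<noteq> u"
    using ab(1) assms(4) N_V(1)[of _ u] N_irrefl(1)[of u] N_V(2)[of v u] N_irrefl(2)[of u] by auto
  have ne: "v \<noteq> a" "v \<noteq> b" using N_sym(1)[of v u] ab(1) assms(2,5) N_sym(1)[of a u] N_sym(1)[of b u] by auto
  let ?P = "\<lambda>C D. (u \<notin> C \<and> u \<notin> D) \<and> v \<in> D"
    and ?Q = "\<lambda>C D. (u \<notin> C \<and> u \<notin> D) \<and> v \<notin> D \<and> a \<in> C"
    and ?R = "\<lambda>C D. (u \<notin> C \<and> u \<notin> D) \<and> v \<notin> D \<and> a \<notin> C \<and> b \<in> C"
  have "cnt (\<lambda>C D. u \<notin> C \<and> u \<notin> D) \<le> cnt ?P + cnt ?Q + cnt ?R"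
    by (rule cnt_le_3) (auto dest!: dominated[OF _ assms(2) ab(1) assms(4)])
  moreover have "cnt ?P \<le> 4 * facet_bound (d - 4)"
    using cnt_none_D_degree[OF assms(2), of v 2] assms by simp
  moreover have "cnt ?Q \<le> 2 * facet_bound (d - 3)"
    using cnt_none_C[of u a "{v}" ?Q] V ne assms by auto
  moreover have "cnt ?R \<le> 4 * facet_bound (d - 4)"
    using cnt_none_C[of u b "{v, a}" ?R] V ne ab assms by auto
  ultimately show ?thesis
    using total_le_degrees[of u 2 1] assms facet_bound_odd[OF assms(1)] facet_bound_pos[of d] by simp
qed

text \<open>The case in which neither refinement of \<open>odd_12_nbr\<close> is available:
  \<open>u\<close> and \<open>x\<close> are each other's only \<open>g\<close>-neighbour and form a
  triangle with \<open>v\<close> in \<open>h\<close>. A second branching on \<open>x\<close> inside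
  each state of \<open>u\<close> gives \<open>121 / 126\<close> of the bound.\<close>

lemma odd_12_triangle:
  assumes "odd d" "u \<in> V" "Ng u = {x}" "Nh u = {v, x}" "Ng x = {u}" "Nh x = {u, v}" "v \<noteq> x"
    "Ng v = {}" "3 \<le> card (Nh v)"
  shows "total \<le> facet_bound d"
proof -
  have V: "x \<in> V" "x \<noteq> u" "v \<in> V" "v \<noteq> u"
    using assms(3,4) N_V(1)[of x u] N_V(2)[of v u] N_irrefl(2)[of u] by auto
  have vu: "v \<in> Nh u" "x \<in> Nh u" "v \<in> Nh x" "u \<in> Nh x" "x \<in> Ng u" "u \<in> Ng x" using assms by auto
  have uC: "cnt (\<lambda>C D. u \<in> C) \<le> 2 * facet_bound (d - 3) + facet_bound (d - 2)"
  proof -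
    have "cnt (\<lambda>C D. u \<in> C) \<le> cnt (\<lambda>C D. u \<in> C \<and> x \<in> D) + cnt (\<lambda>C D. (x \<notin> C \<and> x \<notin> D) \<and> u \<in> C)"
      by (rule cnt_le_2) (use pairD(3)[of _ _ u x] vu in blast)
    moreover have "cnt (\<lambda>C D. u \<in> C \<and> x \<in> D) \<le> 2 ^ card {v} * facet_bound (d - int (card {u, x} + card {v}))"
    proof (rule cnt_pattern[where ?C0.0="{u}" and ?D0.0="{x}"])
      show "\<And>C D. (C, D) \<in> dominating_pairs g h V \<Longrightarrow> u \<in> C \<and> x \<in> D \<Longrightarrow> C \<inter> {u, x} = {u} \<and> D \<inter> {u, x} = {x}"
        using pairD(1,2) by blast
      show "(\<forall>C D. (C, D) \<in> dominating_pairs g h V \<longrightarrow> u \<in> C \<and> x \<in> D \<longrightarrow> s \<notin> C) \<or>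
        (\<forall>C D. (C, D) \<in> dominating_pairs g h V \<longrightarrow> u \<in> C \<and> x \<in> D \<longrightarrow> s \<notin> D)" if "s \<in> {v}" for s
        using that vu(3) pairD(4)[of _ _ x v] by blast
    qed (use V assms in auto)
    moreover have "cnt (\<lambda>C D. (x \<notin> C \<and> x \<notin> D) \<and> u \<in> C) \<le> facet_bound (d - 2)"
      using cnt_none_C[of x u "{}" "\<lambda>C D. (x \<notin> C \<and> x \<notin> D) \<and> u \<in> C"] V assms by simp
    ultimately show ?thesis using V by simp
  qed
  have uD: "cnt (\<lambda>C D. u \<in> D) \<le> 4 * facet_bound (d - 3)"
  proof -
    have "cnt (\<lambda>C D. u \<in> D) \<le> cnt (\<lambda>C D. u \<in> D \<and> x \<in> C) + cnt (\<lambda>C D. (x \<notin> C \<and> x \<notin> D) \<and> u \<in> D)"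
      by (rule cnt_le_2) (use pairD(4)[of _ _ u x] vu in blast)
    moreover have "cnt (\<lambda>C D. u \<in> D \<and> x \<in> C) \<le> 2 ^ card {v} * facet_bound (d - int (card {u, x} + card {v}))"
    proof (rule cnt_pattern[where ?C0.0="{x}" and ?D0.0="{u}"])
      show "\<And>C D. (C, D) \<in> dominating_pairs g h V \<Longrightarrow> u \<in> D \<and> x \<in> C \<Longrightarrow> C \<inter> {u, x} = {x} \<and> D \<inter> {u, x} = {u}"
        using pairD(1,2) by blast
      show "(\<forall>C D. (C, D) \<in> dominating_pairs g h V \<longrightarrow> u \<in> D \<and> x \<in> C \<longrightarrow> s \<notin> C) \<or>
        (\<forall>C D. (C, D) \<in> dominating_pairs g h V \<longrightarrow> u \<in> D \<and> x \<in> C \<longrightarrow> s \<notin> D)" if "s \<in> {v}" for s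
        using that vu(1) pairD(4)[of _ _ u v] by blast
    qed (use V assms in auto)
    moreover have "cnt (\<lambda>C D. (x \<notin> C \<and> x \<notin> D) \<and> u \<in> D) \<le> 2 * facet_bound (d - 3)"
      using cnt_none_D[of x u "{v}" "\<lambda>C D. (x \<notin> C \<and> x \<notin> D) \<and> u \<in> D"] V assms by simp
    ultimately show ?thesis using V by simp
  qed
  have uN: "cnt (\<lambda>C D. u \<notin> C \<and> u \<notin> D) \<le> facet_bound (d - 2) + 2 * facet_bound (d - 3) + 2 * facet_bound (d - 4)"
  proof -
    let ?R = "\<lambda>C D. (u \<notin> C \<and> u \<notin> D) \<and> (x \<notin> C \<and> x \<notin> D) \<and> v \<in> D"
    have "cnt (\<lambda>C D. u \<notin> C \<and> u \<notin> D)
        \<le> cnt (\<lambda>C D. (u \<notin> C \<and> u \<notin> D) \<and> x \<in> C) + cnt (\<lambda>C D. (u \<notin> C \<and> u \<notin> D) \<and> x \<in> D) + cnt ?R"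
      by (rule cnt_le_3) (auto dest!: dominated[OF _ assms(2-4)])
    moreover have "cnt (\<lambda>C D. (u \<notin> C \<and> u \<notin> D) \<and> x \<in> C) \<le> facet_bound (d - 2)"
      using cnt_none_C[of u x "{}" "\<lambda>C D. (u \<notin> C \<and> u \<notin> D) \<and> x \<in> C"] V assms by simp
    moreover have "cnt (\<lambda>C D. (u \<notin> C \<and> u \<notin> D) \<and> x \<in> D) \<le> 2 * facet_bound (d - 3)"
      using cnt_none_D[of u x "{v}" "\<lambda>C D. (u \<notin> C \<and> u \<notin> D) \<and> x \<in> D"] V assms by simp
    moreover have "cnt ?R \<le> 2 * facet_bound (d - 4)"
    proof -
      \<comment> \<open>The third \<open>h\<close>-neighbour of \<open>v\<close> provides another
        vertex with only two states.\<close>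
      have "card {u, x} < card (Nh v)" using assms(9) V by simp
      then have "\<not> Nh v \<subseteq> {u, x}" using card_mono[of "{u, x}" "Nh v"] by auto
      then obtain y where y: "y \<in> Nh v" "y \<noteq> u" "y \<noteq> x" by auto
      then have "y \<in> V" "y \<noteq> v" using N_V N_irrefl by blast+
      have "cnt ?R \<le> 2 ^ card {y} * facet_bound (d - int (card {u, x, v} + card {y}))"
      proof (rule cnt_pattern[where ?C0.0="{}" and ?D0.0="{v}"])
        show "\<And>C D. (C, D) \<in> dominating_pairs g h V \<Longrightarrow> ?R C D \<Longrightarrow> C \<inter> {u, x, v} = {} \<and> D \<inter> {u, x, v} = {v}"
          using pairD(2) by blast
        show "(\<forall>C D. (C, D) \<in> dominating_pairs g h V \<longrightarrow> ?R C D \<longrightarrow> s \<notin> C) \<or>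
          (\<forall>C D. (C, D) \<in> dominating_pairs g h V \<longrightarrow> ?R C D \<longrightarrow> s \<notin> D)" if "s \<in> {y}" for s
          using that y(1) pairD(4)[of _ _ v y] by blast
      qed (use V y \<open>y \<in> V\<close> \<open>y \<noteq> v\<close> assms in auto)
      moreover have "card {u, x, v} = 3" using V assms by auto
      ultimately show ?thesis by simp
    qed
    ultimately show ?thesis by linarith
  qed
  show ?thesis
    using total_le[of u] uC uD uN facet_bound_odd[OF assms(1)] facet_bound_pos[of d] by simp
qed

text \<open>The plain estimate gives \<open>64 / 63\<close> of the bound. Replacing
  \<open>2 * facet_bound (d - 3)\<close> by \<open>4 * facet_bound (d - 4)\<close> in one of the
  branches \<open>?Q\<close> and \<open>?R\<close> brings it to \<open>62 / 63\<close>, so one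
  additional two-state vertex has to be found there.\<close>

lemma odd_12_nbr:
  assumes "odd d" "u \<in> V" "Ng u = {w}" "Nh u = {v, x}" "v \<noteq> x" "Ng v = {}" "3 \<le> card (Nh v)"
    and type: "w = x \<Longrightarrow> card (Ng x) = 2 \<or> (card (Ng x) = 1 \<and> card (Nh x) = 2)"
  shows "total \<le> facet_bound d"
proof -
  have V: "w \<in> V" "w \<noteq> u" "v \<in> V" "v \<noteq> u" "x \<in> V" "x \<noteq> u"
    using assms(3,4) N_V(1)[of _ u] N_irrefl(1)[of u] N_V(2)[of _ u] N_irrefl(2)[of u] by auto
  have nv: "v \<notin> Ng y" if "y \<in> V" for y using N_sym(1)[of v y] that assms(6) by auto
  have ne: "v \<noteq> w" using nv[OF assms(2)] assms(3) by auto
  let ?P = "\<lambda>C D. (u \<notin> C \<and> u \<notin> D) \<and> v \<in> D"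
    and ?Q = "\<lambda>C D. (u \<notin> C \<and> u \<notin> D) \<and> v \<notin> D \<and> x \<in> D"
    and ?R = "\<lambda>C D. (u \<notin> C \<and> u \<notin> D) \<and> v \<notin> D \<and> x \<notin> D \<and> w \<in> C"
  have N: "cnt (\<lambda>C D. u \<notin> C \<and> u \<notin> D) \<le> cnt ?P + cnt ?Q + cnt ?R"
    by (rule cnt_le_3) (auto dest!: dominated[OF _ assms(2-4)])
  have P: "cnt ?P \<le> 4 * facet_bound (d - 4)"
    using cnt_none_D_degree[OF assms(2), of v 2] assms(1-7) by simp
  have Q: "cnt ?Q \<le> 2 * facet_bound (d - 3)"
    using cnt_none_D[of u x "{v}" ?Q] V ne assms(2,5) by simp
  have R: "cnt ?R \<le> 2 * facet_bound (d - 3)"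
    using cnt_none_C[of u w "{v}" ?R] V ne assms(2) by simp
  have good: ?thesis if "cnt ?Q \<le> 4 * facet_bound (d - 4) \<or> cnt ?R \<le> 4 * facet_bound (d - 4)"
    using total_le_degrees[of u 1 2] N P Q R that assms(1-7) facet_bound_odd[OF assms(1)] facet_bound_pos[of d] by auto
  show ?thesis
  proof (cases "w = x")
    \<comment> \<open>In \<open>?R\<close> the vertex \<open>x\<close> is barred from
      \<open>D\<close> and, being different from \<open>w\<close>, still has two states.\<close>
    case False
    have "cnt ?R \<le> 2 ^ card {v, x} * facet_bound (d - int (2 + card {v, x}))"
      by (rule cnt_none_C[of u w "{v, x}" ?R]) (use V ne assms(1-7) False in auto)
    then show ?thesis using good assms(1-7) by simp
  next
    case wx: True
    from type[OF wx] show ?thesis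
    proof
      assume "card (Ng x) = 2"
      moreover have "u \<in> Ng x" using N_sym(1)[of x u] assms(1-7) wx by auto
      ultimately have "card (Ng x - {u}) > 0" by simp
      then obtain y where y: "y \<in> Ng x" "y \<noteq> u" by (auto simp: card_gt_0_iff)
      then have "y \<in> V" "y \<noteq> x" "y \<noteq> v" using N_V N_irrefl nv[of x] V by blast+
      have "cnt ?R \<le> 2 ^ card {v, y} * facet_bound (d - int (2 + card {v, y}))"
        by (rule cnt_none_C[of u w "{v, y}" ?R]) (use V ne assms(1-7) wx y \<open>y \<in> V\<close> \<open>y \<noteq> x\<close> in auto)
      then show ?thesis using good \<open>y \<noteq> v\<close> by simp
    next
      assume *: "card (Ng x) = 1 \<and> card (Nh x) = 2"
      have u: "u \<in> Ng x" "u \<in> Nh x" using N_sym[of x u] assms(1-7) wx by auto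
      obtain z z' where z: "Nh x = {z, z'}" "z \<noteq> z'" using * by (auto simp: card_2_iff)
      obtain y where y: "Nh x = {u, y}" "y \<noteq> u"
        using z u(2) by (cases "z = u") auto
      have "y \<in> Nh x" using y by simp
      then have yV: "y \<in> V" "y \<noteq> x" using N_V N_irrefl by blast+
      have Ngx: "Ng x = {u}" using * u(1) by (metis card_1_singletonE singletonD)
      show ?thesis
      proof (cases "y = v")
        case True
        show ?thesis
          using odd_12_triangle[of u x v] assms(1-7) wx Ngx y True by simp
      next
        case False
        have "cnt ?Q \<le> 2 ^ card {v, y} * facet_bound (d - int (2 + card {v, y}))"
          by (rule cnt_none_D[of u x "{v, y}" ?Q]) (use V ne assms(1-7) y yV in auto)
        then show ?thesis using good False by simp
      qed
    qed
  qed
qed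

section \<open>Structure of a hypothetical counterexample of odd size\<close>

definition exceptional :: bool where
  "exceptional \<longleftrightarrow> odd d \<and> facet_bound d < total"

lemma exceptional_cases:
  assumes "exceptional" "v \<in> V"
  shows "card (Ng v) = 1 \<and> card (Nh v) = 2 \<or> card (Ng v) = 2 \<and> card (Nh v) = 1 \<or>
    Ng v = {} \<and> 2 \<le> card (Nh v) \<or> Nh v = {} \<and> 2 \<le> card (Ng v)"
proof (rule ccontr)
  interpret sw: induction_step h g V by (rule swap)
  assume no: "\<not> ?thesis"
  have odd: "odd d" and gt: "\<not> total \<le> facet_bound d" using assms by (auto simp: exceptional_def)
  have *: "k = 0 \<and> l \<le> 1 \<or> l = 0 \<and> k \<le> 1 \<or> k = 1 \<and> l = 1 \<or> 1 \<le> k \<and> 3 \<le> l \<or> 1 \<le> l \<and> 3 \<le> k \<or> 2 \<le> k \<and> 2 \<le> l"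
    if "\<not> (k = 1 \<and> l = 2 \<or> k = 2 \<and> l = 1 \<or> k = 0 \<and> 2 \<le> l \<or> l = 0 \<and> 2 \<le> k)" for k l :: nat
    using that by presburger
  consider "Ng v = {}" "card (Nh v) \<le> 1" | "Nh v = {}" "card (Ng v) \<le> 1"
    | "card (Ng v) = 1" "card (Nh v) = 1" | "1 \<le> card (Ng v)" "3 \<le> card (Nh v)"
    | "1 \<le> card (Nh v)" "3 \<le> card (Ng v)" | "2 \<le> card (Ng v)" "2 \<le> card (Nh v)"
    using *[of "card (Ng v)" "card (Nh v)"] no by (simp add: card_eq_0_iff) blast
  then show False
  proof cases
    case 1 then show False using odd_0_le1[OF odd assms(2)] gt by simp
  next
    case 2 then show False using sw.odd_0_le1[OF odd assms(2)] gt total_swap by simp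
  next
    case 3
    then obtain u w where "Ng v = {u}" "Nh v = {w}" by (metis card_1_singletonE)
    then show False using total_11[OF assms(2)] gt by blast
  next
    case 4 then show False using odd_13[OF odd assms(2)] gt by simp
  next
    case 5 then show False using sw.odd_13[OF odd assms(2)] gt total_swap by simp
  next
    case 6 then show False using odd_22[OF odd assms(2)] gt by simp
  qed
qed

text \<open>The list of remaining degrees supplies the side condition of \<open>odd_02\<close>: a
  vertex with one \<open>h\<close>-neighbour has exactly two \<open>g\<close>-neighbours.\<close>

lemma exceptional_ge3:
  assumes "exceptional" "v \<in> V" "Ng v = {}"
  shows "3 \<le> card (Nh v)"
proof (rule ccontr)
  assume "\<not> 3 \<le> card (Nh v)"
  then have 2: "card (Nh v) = 2" using exceptional_cases[OF assms(1,2)] assms(3) by auto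
  have "card (Ng u) = 2" if "u \<in> V" "card (Nh u) = 1" for u
    using exceptional_cases[OF assms(1) that(1)] that(2) by auto
  then have "total \<le> facet_bound d"
    using odd_02[OF _ assms(2,3) 2] assms(1) by (simp add: exceptional_def)
  then show False using assms(1) by (simp add: exceptional_def)
qed

text \<open>Among the vertices isolated in \<open>g\<close>, one of least \<open>h\<close>-degree is
  taken. A neighbour of smaller degree cannot be isolated in either graph, so its degrees are one
  and two, which the lemmas on such neighbours exclude. Hence all neighbours have at least the same
  degree and \<open>odd_0_minimal\<close> applies.\<close>

lemma exceptional_Ng:
  assumes "exceptional" "v \<in> V"
  shows "Ng v \<noteq> {}"
proof
  assume "Ng v = {}"
  have odd: "odd d" and gt: "\<not> total \<le> facet_bound d" using assms by (auto simp: exceptional_def)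
  from ex_has_least_nat[of "\<lambda>v. v \<in> V \<and> Ng v = {}" v "\<lambda>v. card (Nh v)"]
  obtain v where v: "v \<in> V" "Ng v = {}"
    and min: "\<And>u. u \<in> V \<Longrightarrow> Ng u = {} \<Longrightarrow> card (Nh v) \<le> card (Nh u)"
    using \<open>v \<in> V\<close> \<open>Ng v = {}\<close> by blast
  have 3: "3 \<le> card (Nh v)" by (rule exceptional_ge3[OF assms(1) v])
  have "card (Nh v) \<le> card (Nh u)" if u: "u \<in> Nh v" for u
  proof (rule ccontr)
    assume no: "\<not> card (Nh v) \<le> card (Nh u)"
    have uV: "u \<in> V" "v \<in> Nh u" using u v N_V N_sym by blast+
    then have "Ng u \<noteq> {}" "Nh u \<noteq> {}" using no min by auto
    then consider "card (Ng u) = 1" "card (Nh u) = 2" | "card (Ng u) = 2" "card (Nh u) = 1"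
      using exceptional_cases[OF assms(1) uV(1)] by blast
    then show False
    proof cases
      case 1
      obtain w where w: "Ng u = {w}" using 1 by (metis card_1_singletonE)
      obtain z z' where z: "Nh u = {z, z'}" "z \<noteq> z'" using 1 by (auto simp: card_2_iff)
      obtain x where x: "Nh u = {v, x}" "v \<noteq> x"
        using z uV(2) by (cases "z = v") auto
      have "card (Ng x) = 2 \<or> (card (Ng x) = 1 \<and> card (Nh x) = 2)" if "w = x"
      proof -
        have "x \<in> V" "u \<in> Ng x" "u \<in> Nh x"
          using w x that uV N_V(2)[of x u] N_sym[of x u] by auto
        then show ?thesis using exceptional_cases[OF assms(1), of x] by auto
      qed
      then show False using odd_12_nbr[OF odd uV(1) w x v(2) 3] gt by blast
    next
      case 2
      then have "Nh u = {v}" using uV(2) by (metis card_1_singletonE singletonD)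
      then show False using odd_21_nbr[OF odd uV(1) 2(1) _ v(2) 3] gt by blast
    qed
  qed
  then show False using odd_0_minimal[OF odd v 3] gt by blast
qed

lemma exceptional_swap: "exceptional \<Longrightarrow> induction_step.exceptional h g V"
  using induction_step.exceptional_def[OF swap] total_swap exceptional_def by simp

lemma odd_case:
  assumes "odd d"
  shows "total \<le> facet_bound d"
proof (rule ccontr)
  interpret sw: induction_step h g V by (rule swap)
  assume "\<not> ?thesis"
  then have ex: "exceptional" using assms by (simp add: exceptional_def)
  have "card (Ng v) + card (Nh v) = 3" if "v \<in> V" for v
    using exceptional_cases[OF ex that] exceptional_Ng[OF ex that] sw.exceptional_Ng[OF exceptional_swap[OF ex] that]
    by auto
  then have "(\<Sum>v\<in>V. card (Ng v) + card (Nh v)) = (\<Sum>v\<in>V. 3)" by (intro sum.cong) auto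
  then have "(\<Sum>v\<in>V. card (Ng v)) + (\<Sum>v\<in>V. card (Nh v)) = 3 * card V" by (simp add: sum.distrib)
  moreover have "even (\<Sum>v\<in>V. card (Ng v))" "even (\<Sum>v\<in>V. card (Nh v))"
    using even_sum_degrees[OF finite_V] g_sym g_irrefl h_sym h_irrefl by blast+
  ultimately have "even (3 * card V)" by (metis even_add)
  then show False using assms by simp
qed

end

section \<open>The bound for all finite vertex sets and its extremal case\<close>

context two_graphs begin

theorem card_dominating_pairs_le:
  assumes "finite V"
  shows "real (card (dominating_pairs g h V)) \<le> facet_bound (int (card V))"
  using assms
proof (induction V rule: finite_psubset_induct)
  case (psubset V)
  then interpret induction_step g h V by unfold_locales auto
  show ?case
  proof (cases "even d")
    case False then show ?thesis by (rule odd_case)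
  next
    case True
    show ?thesis
    proof (cases "V = {}")
      case True
      then have "dominating_pairs g h V = {({}, {})}"
        by (auto simp: dominating_pairs_def indep_pairs_def independent_in_def)
      then show ?thesis using True by (simp add: facet_bound_def)
    next
      case False
      then obtain v where v: "v \<in> V" by blast
      show ?thesis
      proof (cases "\<exists>u. Ng v = {u} \<and> Nh v = {u}")
        case T: True then show ?thesis using total_11[OF v] by blast
      next
        case False then show ?thesis using even_case[OF True v] by simp
      qed
    qed
  qed
qed

theorem neighbours_of_extremal:
  assumes "finite V" "even (card V)" "real (card (dominating_pairs g h V)) = facet_bound (int (card V))" "v \<in> V"
  shows "\<exists>u. neighbours g V v = {u} \<and> neighbours h V v = {u}"
proof -
  interpret induction_step g h V
    using assms(1) card_dominating_pairs_le finite_subset by unfold_locales blast+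
  show ?thesis using even_case[OF _ assms(4)] assms by force
qed

end

section \<open>Perfect matchings and ordinal sums of two-element antichains\<close>

text \<open>A matched pair of vertices has no neighbours elsewhere, so its status can be chosen
  independently of the remaining vertices. Only the lower bound is shown, as the upper bound holds
  in general.\<close>

lemma (in two_graphs) card_dominating_pairs_matching:
  assumes "finite V" "\<And>v. v \<in> V \<Longrightarrow> \<exists>u. neighbours g V v = {u} \<and> neighbours h V v = {u}"
  shows "6 ^ (card V div 2) \<le> card (dominating_pairs g h V)"
  using assms
proof (induction V rule: finite_psubset_induct)
  case (psubset V)
  show ?case
  proof (cases "V = {}")
    case True
    then have "dominating_pairs g h V = {({}, {})}"
      by (auto simp: dominating_pairs_def indep_pairs_def independent_in_def)
    then show ?thesis using True by simp
  next
    case False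
    then obtain v where v: "v \<in> V" by blast
    obtain u where u: "neighbours g V v = {u}" "neighbours h V v = {u}" using psubset.prems[OF v] by blast
    obtain v' where v': "neighbours g V u = {v'}" "neighbours h V u = {v'}"
      using psubset.prems[of u] u by (auto simp: neighbours_def)
    have "v \<in> neighbours g V u" using u(1) v g_sym by (auto simp: neighbours_def)
    then have v'v: "v' = v" using v' by simp
    have uV: "u \<in> V" "u \<noteq> v" using u(1) g_irrefl by (auto simp: neighbours_def)
    have nb: "g v z \<longleftrightarrow> z = u" "g u z \<longleftrightarrow> z = v" "h v z \<longleftrightarrow> z = u" "h u z \<longleftrightarrow> z = v"
      "g z v \<longleftrightarrow> z = u" "g z u \<longleftrightarrow> z = v" "h z v \<longleftrightarrow> z = u" "h z u \<longleftrightarrow> z = v" if "z \<in> V" for z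
      using u v' v'v that g_sym h_sym by (auto simp: neighbours_def)
    define V' where "V' = V - {u, v}"
    have sub: "V' \<subset> V" using v by (auto simp: V'_def)
    have "\<exists>x. neighbours g V' w = {x} \<and> neighbours h V' w = {x}" if w: "w \<in> V'" for w
    proof -
      have wV: "w \<in> V" "w \<noteq> u" "w \<noteq> v" using w by (auto simp: V'_def)
      obtain x where x: "neighbours g V w = {x}" "neighbours h V w = {x}" using psubset.prems[OF wV(1)] by blast
      then have "x \<noteq> u" "x \<noteq> v" using wV nb(5,6)[OF wV(1)] by (auto simp: neighbours_def)
      then have "neighbours g V' w = {x}" "neighbours h V' w = {x}"
        using x by (auto simp: neighbours_def V'_def)
      then show ?thesis by blast
    qed
    from psubset.IH[OF sub this] have IH: "6 ^ (card V' div 2) \<le> card (dominating_pairs g h V')" .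
    \<comment> \<open>These are the six admissible states of the edge: each component contains at
      most one end, no end is used twice, and at least one end is used, which dominates the
      other.\<close>
    define L where "L = {({v}, {}), ({u}, {}), ({}, {v}), ({}, {u}), ({v}, {u}), ({u}, {v})}"
    have "card L = 6" using uV by (auto simp: L_def)
    define F where "F = (\<lambda>(l, e). (fst e \<union> fst l, snd e \<union> snd l) :: 'v set \<times> 'v set)"
    have LV: "fst l \<subseteq> {u, v}" "snd l \<subseteq> {u, v}" if "l \<in> L" for l using that by (auto simp: L_def)
    have EV: "C \<inter> {u, v} = {}" "D \<inter> {u, v} = {}" if "(C, D) \<in> dominating_pairs g h V'" for C D
      using that by (auto simp: dominating_pairs_def indep_pairs_def V'_def)
    have inj: "inj_on F (L \<times> dominating_pairs g h V')"
    proof (rule inj_onI)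
      fix s t assume s: "s \<in> L \<times> dominating_pairs g h V'" and t: "t \<in> L \<times> dominating_pairs g h V'" and eq: "F s = F t"
      obtain A B C D where s': "s = ((A, B), (C, D))" by (metis prod.exhaust)
      obtain A' B' C' D' where t': "t = ((A', B'), (C', D'))" by (metis prod.exhaust)
      have 1: "C \<inter> {u, v} = {}" "D \<inter> {u, v} = {}" "C' \<inter> {u, v} = {}" "D' \<inter> {u, v} = {}"
        using s t EV[of C D] EV[of C' D'] unfolding s' t' by simp_all
      have 2: "A \<subseteq> {u, v}" "B \<subseteq> {u, v}" "A' \<subseteq> {u, v}" "B' \<subseteq> {u, v}"
        using s t LV[of "(A, B)"] LV[of "(A', B')"] unfolding s' t' by simp_all
      have 3: "C \<union> A = C' \<union> A'" "D \<union> B = D' \<union> B'" using eq unfolding s' t' by (simp_all add: F_def)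
      have split: "Y = (Y \<union> Z) - {u, v}" "Z = (Y \<union> Z) \<inter> {u, v}" if "Y \<inter> {u, v} = {}" "Z \<subseteq> {u, v}" for Y Z
        using that by blast+
      have "C = C'" "A = A'" using split[OF 1(1) 2(1)] split[OF 1(3) 2(3)] 3(1) by simp_all
      moreover have "D = D'" "B = B'" using split[OF 1(2) 2(2)] split[OF 1(4) 2(4)] 3(2) by simp_all
      ultimately show "s = t" unfolding s' t' by simp
    qed
    have "F ` (L \<times> dominating_pairs g h V') \<subseteq> dominating_pairs g h V"
    proof clarify
      fix A B C D a b assume AB: "(A, B) \<in> L" and CD: "(C, D) \<in> dominating_pairs g h V'" and ab: "(a, b) = F ((A, B), C, D)"
      have ab: "a = C \<union> A" "b = D \<union> B" using ab by (auto simp: F_def)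
      have CD': "C \<subseteq> V'" "D \<subseteq> V'" "C \<inter> D = {}" "independent_in g C" "independent_in h D"
        "\<And>x. x \<in> V' - C - D \<Longrightarrow> (\<exists>y\<in>C. g x y) \<or> (\<exists>y\<in>D. h x y)"
        using CD by (auto simp: dominating_pairs_def indep_pairs_def)
      have V'nb: "\<not> g z v" "\<not> g z u" "\<not> g v z" "\<not> g u z" "\<not> h z v" "\<not> h z u" "\<not> h v z" "\<not> h u z" if "z \<in> V'" for z
        using nb[of z] that by (auto simp: V'_def)
      have AB': "A \<subseteq> {u, v}" "B \<subseteq> {u, v}" "A \<inter> B = {}" "A = {} \<or> (\<exists>x. A = {x})" "B = {} \<or> (\<exists>x. B = {x})" "A \<union> B \<noteq> {}"
        using AB uV by (auto simp: L_def)
      have un: "independent_in r (C \<union> A)"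
        if prem: "C \<subseteq> V'" "independent_in r C" "A \<subseteq> {u, v}" "A = {} \<or> (\<exists>x. A = {x})"
          "\<And>z. z \<in> V' \<Longrightarrow> \<not> r z v \<and> \<not> r z u \<and> \<not> r v z \<and> \<not> r u z" "\<And>z. \<not> r z z" for r A C
        unfolding independent_in_def
      proof (intro ballI)
        fix y z assume "y \<in> C \<union> A" "z \<in> C \<union> A"
        then consider "y \<in> C" "z \<in> C" | "y \<in> C" "z = u \<or> z = v" | "y = u \<or> y = v" "z \<in> C" | "y \<in> A" "z \<in> A"
          using prem(3) by blast
        then show "\<not> r y z"
        proof cases
          case 1 then show ?thesis using prem(2) by (simp add: independent_in_def)
        next
          case 2 then show ?thesis using prem(5)[of y] prem(1) by blast
        next
          case 3 then show ?thesis using prem(5)[of z] prem(1) by blast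
        next
          case 4 then show ?thesis using prem(4,6) by auto
        qed
      qed
      have "independent_in g (C \<union> A)"
        by (rule un[OF CD'(1,4) AB'(1,4)]) (use V'nb g_irrefl in auto)
      moreover have "independent_in h (D \<union> B)"
        by (rule un[OF CD'(2,5) AB'(2,5)]) (use V'nb h_irrefl in auto)
      moreover have "(C \<union> A) \<inter> (D \<union> B) = {}" "C \<union> A \<subseteq> V" "D \<union> B \<subseteq> V"
        using CD'(1-3) AB'(1-3) v uV by (auto simp: V'_def)
      moreover have "(\<exists>y\<in>C \<union> A. g x y) \<or> (\<exists>y\<in>D \<union> B. h x y)" if x: "x \<in> V - (C \<union> A) - (D \<union> B)" for x
      proof (cases "x \<in> V'")
        case True then show ?thesis using CD'(6)[of x] x by blast
      next
        case False
        then have "x = u \<or> x = v" using x by (auto simp: V'_def)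
        then show ?thesis using AB'(1,2,6) x nb[OF v] nb[OF uV(1)] by blast
      qed
      ultimately show "(a, b) \<in> dominating_pairs g h V"
        unfolding ab by (auto simp: dominating_pairs_def indep_pairs_def)
    qed
    then have "card (F ` (L \<times> dominating_pairs g h V')) \<le> card (dominating_pairs g h V)"
      by (rule card_mono[OF finite_dominating_pairs[OF \<open>finite V\<close>]])
    then have "6 * card (dominating_pairs g h V') \<le> card (dominating_pairs g h V)"
      using \<open>card L = 6\<close> by (simp add: card_image[OF inj] card_cartesian_product)
    moreover have "V = insert u (insert v V')" using v uV by (auto simp: V'_def)
    then have "card V = Suc (Suc (card V'))"
      using uV \<open>finite V\<close> by (metis (no_types, lifting) Diff_iff V'_def card_insert_disjoint finite_Diff finite_insert insert_iff)
    ultimately show ?thesis using IH by simp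
  qed
qed

section \<open>Recognising ordinal sums of two-element antichains by incomparability\<close>

definition incomparables :: "'a poset \<Rightarrow> 'a \<Rightarrow> 'a set" where
  "incomparables P x = {y \<in> fst P. y \<noteq> x \<and> \<not> comparable P x y}"

lemma fst_ordinal_sum_I2: "fst (ordinal_sum_I2 k) = {..<2 * k}"
proof (induction k)
  case (Suc k)
  have "x < 2 * Suc k \<longleftrightarrow> x < 2 * k \<or> x = 2 * k \<or> x = 2 * k + 1" for x by presburger
  then have "{..<2 * Suc k} = {..<2 * k} \<union> {2 * k, 2 * k + 1}"
    by (simp only: set_eq_iff lessThan_iff Un_iff insert_iff empty_iff) blast
  then show ?case using Suc.IH by (simp add: antichain_poset_def ordinal_sum_def)
qed (simp add: antichain_poset_def)

text \<open>The number \<open>x div 2\<close> is the index of the copy that contains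
  \<open>x\<close>.\<close>

lemma snd_ordinal_sum_I2:
  "(x, y) \<in> snd (ordinal_sum_I2 k) \<longleftrightarrow> x < 2 * k \<and> y < 2 * k \<and> (x = y \<or> x div 2 < y div 2)"
proof (induction k)
  case (Suc k)
  have main: "(x, y) \<in> snd (ordinal_sum_I2 (Suc k)) \<longleftrightarrow> (x, y) \<in> snd (ordinal_sum_I2 k) \<or>
      x = y \<and> (x = 2 * k \<or> x = 2 * k + 1) \<or> x < 2 * k \<and> (y = 2 * k \<or> y = 2 * k + 1)"
    by (simp add: ordinal_sum_def antichain_poset_def fst_ordinal_sum_I2 Id_on_iff)
  have e: "z < 2 * k \<longleftrightarrow> z div 2 < k" "z = 2 * k \<or> z = 2 * k + 1 \<longleftrightarrow> z div 2 = k"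
    "z < 2 * Suc k \<longleftrightarrow> z div 2 < k \<or> z div 2 = k" for z by presburger+
  \<comment> \<open>The variable \<open>eq\<close> abstracts \<open>x = y\<close>, of which only the
    equality of the two copy indices is needed.\<close>
  have "a < k \<and> b < k \<and> (eq \<or> a < b) \<or> eq \<and> a = k \<or> a < k \<and> b = k \<longleftrightarrow>
      (a < k \<or> a = k) \<and> (b < k \<or> b = k) \<and> (eq \<or> a < b)" if "eq \<longrightarrow> a = b" for a b :: nat and eq
    using that by (cases eq) auto
  from this[of "x = y" "x div 2" "y div 2"] show ?case unfolding main Suc.IH e by blast
qed (simp add: antichain_poset_def)

declare ordinal_sum_I2.simps [simp del]

lemma incomparables_ordinal_sum_I2:
  assumes "m < 2 * k"
  shows "incomparables (ordinal_sum_I2 k) m = {if even m then m + 1 else m - 1}"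
proof -
  define j where "j = m div 2"
  have half: "z div 2 = j \<longleftrightarrow> z = 2 * j \<or> z = 2 * j + 1" for z by presburger
  have "j < k" and m: "m = 2 * j \<or> m = 2 * j + 1" using assms half[of m] by (auto simp: j_def)
  have "incomparables (ordinal_sum_I2 k) m = {z. z < 2 * k \<and> z \<noteq> m \<and> z div 2 = j}"
    using assms
    by (auto simp: incomparables_def comparable_def fst_ordinal_sum_I2 snd_ordinal_sum_I2 j_def)
  also have "\<dots> = {if even m then m + 1 else m - 1}"
    unfolding half using m \<open>j < k\<close> by auto
  finally show ?thesis .
qed

lemma incomparables_iso:
  assumes "poset_iso P (ordinal_sum_I2 k)" "x \<in> fst P"
  shows "\<exists>y. incomparables P x = {y}"
proof -
  obtain f where f: "bij_betw f (fst P) (fst (ordinal_sum_I2 k))"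
    "\<And>x y. x \<in> fst P \<Longrightarrow> y \<in> fst P \<Longrightarrow> (x, y) \<in> snd P \<longleftrightarrow> (f x, f y) \<in> snd (ordinal_sum_I2 k)"
    using assms(1) by (auto simp: poset_iso_def)
  have fx: "f x \<in> fst (ordinal_sum_I2 k)" using f(1) assms(2) by (auto simp: bij_betw_def)
  have inj: "inj_on f (fst P)" using f(1) by (simp add: bij_betw_def)
  have "f ` incomparables P x = incomparables (ordinal_sum_I2 k) (f x)"
  proof (intro subset_antisym subsetI)
    fix z assume "z \<in> f ` incomparables P x"
    then show "z \<in> incomparables (ordinal_sum_I2 k) (f x)"
      using f(1) assms(2) inj by (auto simp: incomparables_def comparable_def f(2) bij_betw_def inj_on_eq_iff)
  next
    fix z assume z: "z \<in> incomparables (ordinal_sum_I2 k) (f x)"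
    then obtain y where "y \<in> fst P" "z = f y" using f(1) by (auto simp: incomparables_def bij_betw_def)
    then show "z \<in> f ` incomparables P x"
      using z assms(2) by (auto simp: incomparables_def comparable_def f(2))
  qed
  then have "card (f ` incomparables P x) = 1"
    using incomparables_ordinal_sum_I2[of "f x" k] fx by (simp add: fst_ordinal_sum_I2)
  then have "card (incomparables P x) = 1"
    using card_image[OF inj_on_subset[OF inj, of "incomparables P x"]] by (auto simp: incomparables_def)
  then show ?thesis by (metis card_1_singletonE)
qed

text \<open>The top copy is peeled off: a maximal element \<open>x\<close> and its only incomparable
  element \<open>y\<close>. Any other \<open>z\<close> is comparable to \<open>x\<close>, hence
  below it; and \<open>z\<close> is below \<open>y\<close>, because \<open>y\<close> below
  \<open>z\<close> would put \<open>y\<close> below \<open>x\<close>. The rest inherits the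
  hypothesis, since its elements are comparable to both \<open>x\<close> and
  \<open>y\<close>.\<close>

lemma iso_ordinal_sum_I2:
  assumes "is_poset P" "finite (fst P)" "card (fst P) = 2 * k"
    and "\<And>x. x \<in> fst P \<Longrightarrow> \<exists>y. incomparables P x = {y}"
  shows "poset_iso P (ordinal_sum_I2 k)"
  using assms
proof (induction k arbitrary: P)
  case 0
  then show ?case by (auto simp: poset_iso_def fst_ordinal_sum_I2 bij_betw_def)
next
  case (Suc k)
  let ?r = "snd P" and ?X = "fst P"
  have refl: "\<And>x. x \<in> ?X \<Longrightarrow> (x, x) \<in> ?r" and sub: "?r \<subseteq> ?X \<times> ?X"
    and antis: "\<And>x y. (x, y) \<in> ?r \<Longrightarrow> (y, x) \<in> ?r \<Longrightarrow> x = y"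
    and trans: "\<And>x y z. (x, y) \<in> ?r \<Longrightarrow> (y, z) \<in> ?r \<Longrightarrow> (x, z) \<in> ?r"
    using Suc.prems(1) by (auto simp: is_poset_def partial_order_on_def preorder_on_def refl_on_def antisym_def trans_def)
  have "?X \<noteq> {}" using Suc.prems(3) by auto
  have "\<exists>x\<in>?X. \<forall>z\<in>?X. (x, z) \<in> ?r \<longrightarrow> z = x"
  proof -
    define f where "f x = card {z\<in>?X. (x, z) \<in> ?r}" for x
    obtain w where "w \<in> ?X" using \<open>?X \<noteq> {}\<close> by blast
    from ex_has_least_nat[of "\<lambda>x. x \<in> ?X" w f, OF this]
    obtain x where x: "x \<in> ?X" "\<And>z. z \<in> ?X \<Longrightarrow> f x \<le> f z" by blast
    have "z = x" if z: "z \<in> ?X" "(x, z) \<in> ?r" for z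
    proof (rule ccontr)
      assume "z \<noteq> x"
      then have "{y\<in>?X. (z, y) \<in> ?r} \<subset> {y\<in>?X. (x, y) \<in> ?r}"
        using z x(1) refl trans antis by blast
      then have "f z < f x" unfolding f_def by (rule psubset_card_mono[rotated]) (use Suc.prems(2) in auto)
      then show False using x(2)[OF z(1)] by simp
    qed
    then show ?thesis using x(1) by blast
  qed
  then obtain x where x: "x \<in> ?X" and max: "\<And>z. (x, z) \<in> ?r \<Longrightarrow> z = x" using sub by blast
  obtain y where y: "incomparables P x = {y}" using Suc.prems(4)[OF x] by blast
  then have yX: "y \<in> ?X" "y \<noteq> x" "(x, y) \<notin> ?r" "(y, x) \<notin> ?r" by (auto simp: incomparables_def comparable_def)
  have "x \<in> incomparables P y" using x yX by (auto simp: incomparables_def comparable_def)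
  then have y': "incomparables P y = {x}" using Suc.prems(4)[OF yX(1)] by auto
  have zx: "(z, x) \<in> ?r" if "z \<in> ?X" "z \<noteq> y" for z
  proof -
    have "z \<notin> incomparables P x" using that y by simp
    then show ?thesis using that max refl x by (auto simp: incomparables_def comparable_def)
  qed
  have zy: "(z, y) \<in> ?r \<and> (y, z) \<notin> ?r" if "z \<in> ?X" "z \<noteq> y" "z \<noteq> x" for z
  proof -
    have "z \<notin> incomparables P y" using that y' by simp
    moreover have "(y, z) \<notin> ?r" using zx[OF that(1,2)] trans yX(4) by blast
    ultimately show ?thesis using that by (auto simp: incomparables_def comparable_def)
  qed
  define X' where "X' = ?X - {x, y}"
  define P' where "P' = (X', ?r \<inter> X' \<times> X')"
  have fP': "fst P' = X'" "snd P' = ?r \<inter> X' \<times> X'" by (simp_all add: P'_def)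
  have "poset_iso P' (ordinal_sum_I2 k)"
  proof (rule Suc.IH)
    show "is_poset P'"
    proof -
      have "refl_on X' (?r \<inter> X' \<times> X')" using refl by (auto simp: refl_on_def X'_def)
      moreover have "trans (?r \<inter> X' \<times> X')" by (rule transI) (use trans in blast)
      moreover have "antisym (?r \<inter> X' \<times> X')" by (rule antisymI) (use antis in blast)
      ultimately show ?thesis by (auto simp: is_poset_def partial_order_on_def preorder_on_def fP')
    qed
    show "finite (fst P')" using Suc.prems(2) by (simp add: fP' X'_def)
    show "card (fst P') = 2 * k"
      using Suc.prems(2,3) x yX by (simp add: fP' X'_def card_Diff_subset)
    show "\<exists>w. incomparables P' z = {w}" if z: "z \<in> fst P'" for z
    proof -
      have zX: "z \<in> ?X" "z \<noteq> x" "z \<noteq> y" using z by (auto simp: fP' X'_def)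
      have "incomparables P z \<subseteq> X'" using zx[of z] zy[of z] zX by (auto simp: incomparables_def comparable_def X'_def)
      then have "incomparables P' z = incomparables P z"
        using z by (auto simp: incomparables_def comparable_def fP' X'_def)
      then show ?thesis using Suc.prems(4)[OF zX(1)] by simp
    qed
  qed
  then obtain f where f: "bij_betw f X' {..<2 * k}"
    and fr: "\<And>a b. a \<in> X' \<Longrightarrow> b \<in> X' \<Longrightarrow> (a, b) \<in> ?r \<longleftrightarrow> (f a, f b) \<in> snd (ordinal_sum_I2 k)"
    by (auto simp: poset_iso_def fP' fst_ordinal_sum_I2)
  define f' where "f' z = (if z = x then 2 * k else if z = y then 2 * k + 1 else f z)" for z
  have X: "?X = insert x (insert y X')" using x yX by (auto simp: X'_def)
  have xyX': "x \<notin> X'" "y \<notin> X'" by (auto simp: X'_def)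
  have f'X': "f' z = f z" "f z < 2 * k" if "z \<in> X'" for z
    using that xyX' f by (auto simp: f'_def bij_betw_def)
  have f'x: "f' x = 2 * k" "f' y = 2 * k + 1" using yX by (auto simp: f'_def)
  have "bij_betw f' X' {..<2 * k}" using f f'X' bij_betw_cong[of X' f' f] by blast
  then have "bij_betw f' (insert y X') (insert (2 * k + 1) {..<2 * k})"
    using notIn_Un_bij_betw[of y X' f' "{..<2 * k}"] xyX' f'x by simp
  then have "bij_betw f' (insert x (insert y X')) (insert (2 * k) (insert (2 * k + 1) {..<2 * k}))"
    using notIn_Un_bij_betw[of x "insert y X'" f' "insert (2 * k + 1) {..<2 * k}"] xyX' yX f'x by simp
  moreover have "insert (2 * k) (insert (2 * k + 1) {..<2 * k}) = {..<2 * Suc k}" by auto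
  ultimately have bij: "bij_betw f' ?X (fst (ordinal_sum_I2 (Suc k)))" by (simp add: X fst_ordinal_sum_I2)
  have "(a, b) \<in> ?r \<longleftrightarrow> (f' a, f' b) \<in> snd (ordinal_sum_I2 (Suc k))" if ab: "a \<in> ?X" "b \<in> ?X" for a b
  proof -
    have div: "m div 2 < k" if "m < 2 * k" for m :: nat using that by presburger
    have ab': "a = x \<or> a = y \<or> a \<in> X'" "b = x \<or> b = y \<or> b \<in> X'" using ab unfolding X by simp_all
    consider "a \<in> X'" "b \<in> X'" | "a \<in> X'" "b = x" | "a \<in> X'" "b = y" | "a = x" "b \<in> X'" | "a = y" "b \<in> X'"
      | "a = x" "b = y" | "a = y" "b = x" | "a = b" using ab' by blast
    then show ?thesis
    proof cases
      case 1
      then show ?thesis using fr[of a b] f'X'[of a] f'X'[of b] by (auto simp: snd_ordinal_sum_I2)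
    next
      case 2
      then have "(a, b) \<in> ?r" using zx[of a] by (auto simp: X'_def)
      then show ?thesis using 2 f'x f'X'[of a] div[of "f a"] by (simp add: snd_ordinal_sum_I2)
    next
      case 3
      then have "(a, b) \<in> ?r" using zy[of a] by (auto simp: X'_def)
      then show ?thesis using 3 f'x f'X'[of a] div[of "f a"] by (simp add: snd_ordinal_sum_I2)
    next
      case 4
      then have "(a, b) \<notin> ?r" using max[of b] by (auto simp: X'_def)
      then show ?thesis using 4 f'x f'X'[of b] div[of "f b"] by (simp add: snd_ordinal_sum_I2)
    next
      case 5
      then have "(a, b) \<notin> ?r" using zy[of b] by (auto simp: X'_def)
      then show ?thesis using 5 f'x f'X'[of b] div[of "f b"] by (simp add: snd_ordinal_sum_I2)
    next
      case 6 then show ?thesis using yX f'x by (simp add: snd_ordinal_sum_I2)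
    next
      case 7 then show ?thesis using yX f'x by (simp add: snd_ordinal_sum_I2)
    next
      case 8
      have "f' a \<in> fst (ordinal_sum_I2 (Suc k))" using bij ab by (auto simp: bij_betw_def)
      then show ?thesis using 8 refl ab by (simp add: snd_ordinal_sum_I2 fst_ordinal_sum_I2)
    qed
  qed
  then show ?case using bij unfolding poset_iso_def by blast
qed

section \<open>Comparability graphs in coordinates and the equality case\<close>

lemma comparability_graph_edge:
  assumes "x \<in> fst P" "y \<in> fst P"
  shows "{x, y} \<in> snd (comparability_graph P) \<longleftrightarrow> x \<noteq> y \<and> comparable P x y"
  using assms by (auto simp: comparability_graph_def doubleton_eq_iff comparable_def)

text \<open>The map \<open>q \<circ> inv p\<close> sends each \<open>p i\<close> to
  \<open>q i\<close>, so it is a bijection for free and only the agreement of edges remains.\<close>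

lemma graph_isomorphism_labelled:
  assumes "bij_betw p UNIV (fst P)" "bij_betw q UNIV (fst Q)"
  shows "graph_isomorphism (q \<circ> inv p) (comparability_graph P) (comparability_graph Q) \<longleftrightarrow>
    (\<forall>i j. i \<noteq> j \<longrightarrow> (comparable P (p i) (p j) \<longleftrightarrow> comparable Q (q i) (q j)))"
proof -
  have p: "inj p" "range p = fst P" and q: "inj q" "range q = fst Q" using assms by (auto simp: bij_betw_def)
  have "bij_betw (inv p) (fst P) UNIV" using assms(1) by (metis bij_betw_inv_into)
  then have "bij_betw (q \<circ> inv p) (fst P) (fst Q)" using assms(2) by (rule bij_betw_trans)
  then have "graph_isomorphism (q \<circ> inv p) (comparability_graph P) (comparability_graph Q) \<longleftrightarrow>
      (\<forall>x\<in>fst P. \<forall>y\<in>fst P. {x, y} \<in> snd (comparability_graph P) \<longleftrightarrow>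
        {q (inv p x), q (inv p y)} \<in> snd (comparability_graph Q))"
    by (simp add: graph_isomorphism_def comparability_graph_def)
  also have "\<dots> \<longleftrightarrow> (\<forall>i j. {p i, p j} \<in> snd (comparability_graph P) \<longleftrightarrow> {q i, q j} \<in> snd (comparability_graph Q))"
    unfolding p(2)[symmetric] using p(1) by simp
  also have "\<dots> \<longleftrightarrow> (\<forall>i j. i \<noteq> j \<longrightarrow> (comparable P (p i) (p j) \<longleftrightarrow> comparable Q (q i) (q j)))"
  proof -
    have "p i \<in> fst P" "q i \<in> fst Q" for i using p q by auto
    then have "{p i, p j} \<in> snd (comparability_graph P) \<longleftrightarrow> i \<noteq> j \<and> comparable P (p i) (p j)"
      "{q i, q j} \<in> snd (comparability_graph Q) \<longleftrightarrow> i \<noteq> j \<and> comparable Q (q i) (q j)" for i j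
      using p(1) q(1) by (simp_all add: comparability_graph_edge inj_eq)
    then show ?thesis by blast
  qed
  finally show ?thesis .
qed

definition incomp_graph :: "'a poset \<Rightarrow> ('n \<Rightarrow> 'a) \<Rightarrow> 'n \<Rightarrow> 'n \<Rightarrow> bool" where
  "incomp_graph P p i j \<longleftrightarrow> i \<noteq> j \<and> \<not> comparable P (p i) (p j)"

lemma two_graphs_incomp: "two_graphs (incomp_graph P p) (incomp_graph Q q)"
  by unfold_locales (auto simp: incomp_graph_def comparable_def)

lemma iso_ordinal_sum_I2_iff:
  fixes p :: "'n::finite \<Rightarrow> 'a"
  assumes "is_poset P" "bij_betw p UNIV (fst P)" "even CARD('n)"
  shows "poset_iso P (ordinal_sum_I2 (CARD('n) div 2)) \<longleftrightarrow> (\<forall>i. \<exists>j. neighbours (incomp_graph P p) UNIV i = {j})"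
proof -
  have p: "inj p" "range p = fst P" using assms by (auto simp: bij_betw_def)
  have im: "incomparables P (p i) = p ` neighbours (incomp_graph P p) UNIV i" for i
    using p by (auto simp: incomparables_def neighbours_def incomp_graph_def inj_eq)
  have card: "card (fst P) = 2 * (CARD('n) div 2)" using p(2) card_image[OF p(1)] assms(3) by simp
  have fin: "finite (fst P)" unfolding p(2)[symmetric] by simp
  have "poset_iso P (ordinal_sum_I2 (CARD('n) div 2)) \<longleftrightarrow> (\<forall>x\<in>fst P. \<exists>y. incomparables P x = {y})"
  proof
    assume "poset_iso P (ordinal_sum_I2 (CARD('n) div 2))"
    then show "\<forall>x\<in>fst P. \<exists>y. incomparables P x = {y}" by (intro ballI incomparables_iso)
  next
    assume "\<forall>x\<in>fst P. \<exists>y. incomparables P x = {y}"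
    then show "poset_iso P (ordinal_sum_I2 (CARD('n) div 2))"
      by (intro iso_ordinal_sum_I2[OF assms(1) fin card]) simp
  qed
  also have "\<dots> \<longleftrightarrow> (\<forall>i. \<exists>y. p ` neighbours (incomp_graph P p) UNIV i = {y})"
    unfolding p(2)[symmetric] by (simp add: im)
  also have "\<dots> \<longleftrightarrow> (\<forall>i. card (p ` neighbours (incomp_graph P p) UNIV i) = 1)"
    by (simp add: card_1_singleton_iff)
  also have "\<dots> \<longleftrightarrow> (\<forall>i. \<exists>j. neighbours (incomp_graph P p) UNIV i = {j})"
    using card_image[OF inj_on_subset[OF p(1) subset_UNIV]] by (simp add: card_1_singleton_iff)
  finally show ?thesis .
qed

lemma extremal_iff:
  fixes p q :: "'n::finite \<Rightarrow> 'a"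
  assumes "is_poset P" "is_poset Q" "bij_betw p UNIV (fst P)" "bij_betw q UNIV (fst Q)" "even CARD('n)"
  shows "card (dominating_pairs (incomp_graph P p) (incomp_graph Q q) UNIV) = 6 ^ (CARD('n) div 2) \<longleftrightarrow>
    poset_iso P (ordinal_sum_I2 (CARD('n) div 2)) \<and> poset_iso Q (ordinal_sum_I2 (CARD('n) div 2)) \<and>
    graph_isomorphism (q \<circ> inv p) (comparability_graph P) (comparability_graph Q)"
    (is "card (dominating_pairs ?g ?h UNIV) = _ \<longleftrightarrow> ?R")
proof -
  interpret two_graphs ?g ?h by (rule two_graphs_incomp)
  have fb: "facet_bound (int CARD('n)) = real (6 ^ (CARD('n) div 2))"
    using assms(5) by (simp add: facet_bound_def power_int_def nat_div_distrib)
  have "card (dominating_pairs ?g ?h UNIV) = 6 ^ (CARD('n) div 2) \<longleftrightarrow>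
      (\<forall>i. \<exists>j. neighbours ?g UNIV i = {j} \<and> neighbours ?h UNIV i = {j})"
  proof
    assume "card (dominating_pairs ?g ?h UNIV) = 6 ^ (CARD('n) div 2)"
    then have eq: "real (card (dominating_pairs ?g ?h UNIV)) = facet_bound (int CARD('n))" using fb by simp
    then show "\<forall>i. \<exists>j. neighbours ?g UNIV i = {j} \<and> neighbours ?h UNIV i = {j}"
      using neighbours_of_extremal[OF finite assms(5) eq] by blast
  next
    assume "\<forall>i. \<exists>j. neighbours ?g UNIV i = {j} \<and> neighbours ?h UNIV i = {j}"
    then have "6 ^ (CARD('n) div 2) \<le> card (dominating_pairs ?g ?h UNIV)"
      using card_dominating_pairs_matching[of UNIV] by simp
    moreover have "card (dominating_pairs ?g ?h UNIV) \<le> 6 ^ (CARD('n) div 2)"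
      using card_dominating_pairs_le[of UNIV] unfolding fb of_nat_le_iff by simp
    ultimately show "card (dominating_pairs ?g ?h UNIV) = 6 ^ (CARD('n) div 2)" by simp
  qed
  also have "\<dots> \<longleftrightarrow> ?R"
  proof -
    \<comment> \<open>Equal comparabilities mean equal neighbourhoods, which turns two unique
      neighbours into a common one.\<close>
    have "(\<forall>i j. i \<noteq> j \<longrightarrow> (comparable P (p i) (p j) \<longleftrightarrow> comparable Q (q i) (q j))) \<longleftrightarrow>
        (\<forall>i. neighbours ?g UNIV i = neighbours ?h UNIV i)"
      by (auto simp: neighbours_def incomp_graph_def set_eq_iff)
    then show ?thesis
      unfolding iso_ordinal_sum_I2_iff[OF assms(1,3,5)] iso_ordinal_sum_I2_iff[OF assms(2,4,5)]
        graph_isomorphism_labelled[OF assms(3,4)] by metis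
  qed
  finally show ?thesis .
qed

section \<open>The facets of the twinned chain polytope\<close>

text \<open>The vector \<open>y\<close> is maximised over \<open>U\<close> by \<open>u\<close>
  alone. Scaled one way it violates only the inequality of \<open>u\<close>, which shows
  irredundancy; scaled another way it satisfies only that one with equality, which shows that
  different \<open>u\<close> define different facets.\<close>

lemma num_facets_halfspaces:
  fixes U :: "'v::euclidean_space set"
  assumes "finite U"
    and sep: "\<And>u. u \<in> U \<Longrightarrow> \<exists>y. u \<bullet> y > 0 \<and> (\<forall>u'\<in>U - {u}. u' \<bullet> y < u \<bullet> y)"
  shows "num_facets {x. \<forall>u\<in>U. u \<bullet> x \<le> 1} = card U"
proof -
  define S where "S = {x. \<forall>u\<in>U. u \<bullet> x \<le> 1}"
  define H where "H u = {x::'v. u \<bullet> x \<le> 1}" for u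
  have out: "\<exists>z. u \<bullet> z > 1 \<and> (\<forall>u'\<in>U - {u}. u' \<bullet> z \<le> 1)" if u: "u \<in> U" for u
  proof -
    obtain y where y: "u \<bullet> y > 0" "\<And>u'. u' \<in> U - {u} \<Longrightarrow> u' \<bullet> y < u \<bullet> y" using sep[OF u] by blast
    \<comment> \<open>The entry \<open>u \<bullet> y / 2\<close> makes \<open>M\<close> positive
      even if all other values are not, so dividing by \<open>M\<close> is legitimate.\<close>
    define M where "M = Max (insert (u \<bullet> y / 2) ((\<lambda>u'. u' \<bullet> y) ` (U - {u})))"
    have fin: "finite (insert (u \<bullet> y / 2) ((\<lambda>u'. u' \<bullet> y) ` (U - {u})))" using assms(1) by simp
    have "M < u \<bullet> y" unfolding M_def using fin y by (subst Max_less_iff) auto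
    moreover have "u \<bullet> y / 2 \<le> M" unfolding M_def by (rule Max_ge[OF fin]) simp
    moreover have "u' \<bullet> y \<le> M" if "u' \<in> U - {u}" for u'
      unfolding M_def by (rule Max_ge[OF fin]) (use that in blast)
    ultimately show ?thesis
      using y(1) by (intro exI[of _ "y /\<^sub>R M"]) (auto simp: inverse_eq_divide)
  qed
  have on: "\<exists>z. u \<bullet> z = 1 \<and> (\<forall>u'\<in>U - {u}. u' \<bullet> z < 1)" if u: "u \<in> U" for u
  proof -
    obtain y where y: "u \<bullet> y > 0" "\<And>u'. u' \<in> U - {u} \<Longrightarrow> u' \<bullet> y < u \<bullet> y" using sep[OF u] by blast
    then show ?thesis by (intro exI[of _ "y /\<^sub>R (u \<bullet> y)"]) (auto simp: inverse_eq_divide)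
  qed
  have injH: "inj_on H U"
  proof (rule inj_onI, rule ccontr)
    fix u u' assume uu': "u \<in> U" "u' \<in> U" "H u = H u'" "u \<noteq> u'"
    obtain z where z: "u \<bullet> z > 1" "\<And>u'. u' \<in> U - {u} \<Longrightarrow> u' \<bullet> z \<le> 1" using out[OF uu'(1)] by blast
    have "z \<notin> H u" using z(1) by (simp add: H_def)
    moreover have "z \<in> H u'" using z(2)[of u'] uu' by (simp add: H_def)
    ultimately show False using uu'(3) by simp
  qed
  \<comment> \<open>The polyhedron is full-dimensional, since the origin satisfies all inequalities
    strictly.\<close>
  have aff: "affine hull S = UNIV"
  proof (rule affine_hull_nonempty_interior)
    let ?W = "\<Inter>u\<in>U. {x. u \<bullet> x < 1}"
    have "open ?W" using assms(1) by (intro open_INT) (auto intro: open_halfspace_lt)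
    moreover have "?W \<subseteq> S" by (auto simp: S_def intro: less_imp_le)
    ultimately have "?W \<subseteq> interior S" by (rule interior_maximal[rotated])
    moreover have "0 \<in> ?W" by simp
    ultimately show "interior S \<noteq> {}" by blast
  qed
  have facets: "C facet_of S \<longleftrightarrow> (\<exists>h. h \<in> H ` U \<and> C = S \<inter> {x. inv_into U H h \<bullet> x = 1})" for C
  proof (rule facet_of_polyhedron_explicit)
    show "finite (H ` U)" using assms(1) by simp
    show "S = affine hull S \<inter> \<Inter>(H ` U)" unfolding aff by (auto simp: S_def H_def)
    show "inv_into U H h \<noteq> 0 \<and> h = {x. inv_into U H h \<bullet> x \<le> 1}" if "h \<in> H ` U" for h
    proof -
      obtain u where u: "u \<in> U" "h = H u" using \<open>h \<in> H ` U\<close> by blast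
      then have "inv_into U H h = u" using injH by simp
      moreover have "u \<noteq> 0" using sep[OF u(1)] by auto
      ultimately show ?thesis using u(2) by (simp add: H_def)
    qed
    show "S \<subset> affine hull S \<inter> \<Inter>F'" if "F' \<subset> H ` U" for F'
    proof -
      obtain u where u: "u \<in> U" "H u \<notin> F'" using \<open>F' \<subset> H ` U\<close> by blast
      obtain z where z: "u \<bullet> z > 1" "\<And>u'. u' \<in> U - {u} \<Longrightarrow> u' \<bullet> z \<le> 1" using out[OF u(1)] by blast
      have "z \<in> \<Inter>F'"
      proof
        fix h assume "h \<in> F'"
        then obtain u' where "u' \<in> U" "h = H u'" "u' \<noteq> u" using \<open>F' \<subset> H ` U\<close> u(2) by blast
        then show "z \<in> h" using z(2) by (simp add: H_def)
      qed
      moreover have "z \<notin> S" unfolding S_def mem_Collect_eq using z(1) u(1) by (meson not_le)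
      moreover have "S \<subseteq> \<Inter>F'" using \<open>F' \<subset> H ` U\<close> by (auto simp: S_def H_def)
      ultimately show ?thesis unfolding aff by blast
    qed
  qed
  have "{C. C facet_of S} = (\<lambda>u. S \<inter> {x. u \<bullet> x = 1}) ` U"
    unfolding facets using injH by (auto simp: image_iff)
  moreover have "inj_on (\<lambda>u. S \<inter> {x. u \<bullet> x = 1}) U"
  proof (rule inj_onI, rule ccontr)
    fix u u' assume uu': "u \<in> U" "u' \<in> U" "S \<inter> {x. u \<bullet> x = 1} = S \<inter> {x. u' \<bullet> x = 1}" "u \<noteq> u'"
    obtain z where z: "u \<bullet> z = 1" "\<And>u'. u' \<in> U - {u} \<Longrightarrow> u' \<bullet> z < 1" using on[OF uu'(1)] by blast
    have "v \<bullet> z \<le> 1" if "v \<in> U" for v using z that by (cases "v = u") (auto intro: less_imp_le)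
    then have "z \<in> S \<inter> {x. u \<bullet> x = 1}" using z(1) by (simp add: S_def)
    moreover have "u' \<bullet> z \<noteq> 1" using z(2)[of u'] uu' by auto
    ultimately show False using uu'(3) by blast
  qed
  ultimately show ?thesis unfolding num_facets_def S_def[symmetric] by (simp add: card_image)
qed

section \<open>Inequality description of the twinned chain polytope\<close>

definition indicator_vec :: "'n::finite set \<Rightarrow> real ^ 'n" where
  "indicator_vec A = (\<chi> i. if i \<in> A then 1 else 0)"

lemma inner_indicator_vec: "indicator_vec A \<bullet> x = (\<Sum>i\<in>A. x $ i)"
  by (simp add: indicator_vec_def inner_vec_def if_distrib[of "\<lambda>c. c * _"] sum.If_cases cong: if_cong)

lemma rho_eq_indicator_vec: "rho p A = indicator_vec {i. p i \<in> A}"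
  by (simp add: rho_def indicator_vec_def vec_eq_iff axis_def sum.If_cases)

lemma antichain_points:
  fixes p :: "'n::finite \<Rightarrow> 'a"
  assumes "bij_betw p UNIV (fst P)"
  shows "{rho p A |A. antichain_of P A} =
    indicator_vec ` {S. \<forall>i\<in>S. \<forall>j\<in>S. i \<noteq> j \<longrightarrow> incomp_graph P p i j}" (is "?L = ?R")
proof (intro subset_antisym subsetI)
  have inj: "inj p" and ran: "range p = fst P" using assms by (auto simp: bij_betw_def)
  fix x
  {
    assume "x \<in> ?L"
    then obtain A where "antichain_of P A" "x = indicator_vec {i. p i \<in> A}"
      unfolding rho_eq_indicator_vec by blast
    then show "x \<in> ?R" using inj by (auto simp: antichain_of_def incomp_graph_def inj_eq)
  next
    assume "x \<in> ?R"
    then obtain S where S: "\<forall>i\<in>S. \<forall>j\<in>S. i \<noteq> j \<longrightarrow> incomp_graph P p i j" "x = indicator_vec S" by blast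
    then have "antichain_of P (p ` S)" using ran by (auto simp: antichain_of_def incomp_graph_def)
    moreover have "{i. p i \<in> p ` S} = S" using inj by (auto simp: inj_eq)
    ultimately show "x \<in> ?L" unfolding rho_eq_indicator_vec using S(2)
      by (intro CollectI exI[of _ "p ` S"]) simp
  }
qed

lemma antichain_in_chain_polytope:
  fixes p :: "'n::finite \<Rightarrow> 'a"
  assumes "bij_betw p UNIV (fst P)" "\<And>i j. i \<in> S \<Longrightarrow> j \<in> S \<Longrightarrow> i \<noteq> j \<Longrightarrow> incomp_graph P p i j"
  shows "indicator_vec S \<in> chain_polytope P p"
  unfolding chain_polytope_def antichain_points[OF assms(1)]
  by (rule hull_inc) (use assms(2) in blast)

lemma zero_in_chain_polytope:
  fixes p :: "'n::finite \<Rightarrow> 'a"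
  assumes "bij_betw p UNIV (fst P)"
  shows "0 \<in> chain_polytope P p"
  using antichain_in_chain_polytope[OF assms, of "{}"] by (simp add: indicator_vec_def zero_vec_def)

text \<open>Greedy decomposition into antichains: peeling off a suitable multiple of the minimal elements
  of the support of \<open>x\<close> kills a coordinate and lowers every chain sum, since each chain can be
  extended by such a minimal element.\<close>

lemma chain_polytope_scaled:
  fixes p :: "'n::finite \<Rightarrow> 'a" and x :: "real ^ 'n"
  assumes P: "is_poset P" and p: "bij_betw p UNIV (fst P)"
    and "\<And>i. 0 \<le> x $ i" "\<And>K. independent_in (incomp_graph P p) K \<Longrightarrow> (\<Sum>i\<in>K. x $ i) \<le> t"
  shows "\<exists>y\<in>chain_polytope P p. x = t *\<^sub>R y"
  using assms(3,4)
proof (induction "card {i. x $ i \<noteq> 0}" arbitrary: x t rule: less_induct)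
  case less
  define le where "le i j \<longleftrightarrow> (p i, p j) \<in> snd P" for i j
  have inj: "inj p" and ran: "range p = fst P" using p by (auto simp: bij_betw_def)
  have le_refl: "le i i" for i
    using P ran by (auto simp: le_def is_poset_def partial_order_on_def preorder_on_def refl_on_def)
  have le_trans: "le i k" if "le i j" "le j k" for i j k
    using P that by (auto simp: le_def is_poset_def partial_order_on_def preorder_on_def intro: transD)
  have le_antisym: "i = j" if "le i j" "le j i" for i j
    using P that inj by (auto simp: le_def is_poset_def partial_order_on_def inj_eq dest: antisymD)
  have g: "incomp_graph P p i j \<longleftrightarrow> i \<noteq> j \<and> \<not> le i j \<and> \<not> le j i" for i j
    by (auto simp: incomp_graph_def comparable_def le_def)
  have minimal: "\<exists>m\<in>S. \<forall>j\<in>S. le j m \<longrightarrow> j = m" if "i \<in> S" for S i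
  proof -
    from ex_has_least_nat[of "\<lambda>m. m \<in> S" i "\<lambda>m. card {k. le k m}", OF that]
    obtain m where m: "m \<in> S" "\<And>j. j \<in> S \<Longrightarrow> card {k. le k m} \<le> card {k. le k j}" by blast
    have "j = m" if "j \<in> S" "le j m" for j
    proof (rule ccontr)
      assume "j \<noteq> m"
      then have "\<not> le m j" using le_antisym that(2) by blast
      then have "{k. le k j} \<subset> {k. le k m}" using le_trans[OF _ that(2)] le_refl[of m] by blast
      then have "card {k. le k j} < card {k. le k m}" by (intro psubset_card_mono) auto
      then show False using m(2)[OF that(1)] by simp
    qed
    then show ?thesis using m(1) by blast
  qed
  define supp where "supp = {i. x $ i \<noteq> 0}"
  show ?case
  proof (cases "supp = {}")
    case True
    then have "x = t *\<^sub>R 0" by (simp add: supp_def vec_eq_iff)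
    then show ?thesis using zero_in_chain_polytope[OF p] by blast
  next
    case False
    define A where "A = {i\<in>supp. \<forall>j\<in>supp. le j i \<longrightarrow> j = i}"
    have A_below: "\<exists>a\<in>A. le a i" if i: "i \<in> supp" for i
    proof -
      obtain m where m: "m \<in> supp" "le m i" "\<And>j. j \<in> supp \<Longrightarrow> le j i \<Longrightarrow> le j m \<Longrightarrow> j = m"
        using minimal[of i "{j\<in>supp. le j i}"] i le_refl by auto
      have "j = m" if "j \<in> supp" "le j m" for j
        by (rule m(3)[OF that(1) le_trans[OF that(2) m(2)] that(2)])
      then have "m \<in> A" using m(1) by (simp add: A_def)
      then show ?thesis using m(2) by blast
    qed
    have "A \<noteq> {}" using A_below False by blast
    \<comment> \<open>The smallest coordinate over \<open>A\<close>: subtracting it keeps all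
      coordinates non-negative and makes at least one of them vanish.\<close>
    define e where "e = Min ((\<lambda>i. x $ i) ` A)"
    have "e \<in> (\<lambda>i. x $ i) ` A" unfolding e_def using \<open>A \<noteq> {}\<close> by (intro Min_in) auto
    then obtain a0 where a0: "a0 \<in> A" "e = x $ a0" by blast
    have e_le: "e \<le> x $ i" if "i \<in> A" for i unfolding e_def using that by (intro Min_le) auto
    have "e > 0" using a0 less.prems(1)[of a0] by (auto simp: A_def supp_def less_le)
    have sing: "x $ i \<le> t" for i
      using less.prems(2)[of "{i}"] by (simp add: independent_in_def incomp_graph_def)
    then have "e \<le> t" using a0 by simp
    define x' where "x' = x - e *\<^sub>R indicator_vec A"
    have x'i: "x' $ i = (if i \<in> A then x $ i - e else x $ i)" for i by (simp add: x'_def indicator_vec_def)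
    have "{i. x' $ i \<noteq> 0} \<subset> {i. x $ i \<noteq> 0}"
      using a0 by (auto simp: x'i A_def supp_def)
    then have "card {i. x' $ i \<noteq> 0} < card {i. x $ i \<noteq> 0}" by (intro psubset_card_mono) auto
    moreover have "0 \<le> x' $ i" for i using e_le[of i] less.prems(1)[of i] by (simp add: x'i)
    moreover have "(\<Sum>i\<in>K. x' $ i) \<le> t - e" if K: "independent_in (incomp_graph P p) K" for K
    proof -
      have chain: "le i j \<or> le j i" if "i \<in> K" "j \<in> K" for i j
        using K that le_refl[of i] by (cases "i = j") (auto simp: independent_in_def g)
      have sum': "(\<Sum>i\<in>K. x' $ i) = (\<Sum>i\<in>K. x $ i) - e * card (K \<inter> A)"
      proof -
        have "(\<Sum>i\<in>K. x' $ i) = (\<Sum>i\<in>K. x $ i - (if i \<in> A then e else 0))" by (intro sum.cong) (auto simp: x'i)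
        then show ?thesis by (simp add: sum_subtractf sum.If_cases Int_def)
      qed
      show ?thesis
      proof (cases "K \<inter> A = {}")
        case False
        then have "1 \<le> card (K \<inter> A)" by (simp add: Suc_le_eq card_gt_0_iff)
        then have "e \<le> e * card (K \<inter> A)" using \<open>e > 0\<close> by simp
        then show ?thesis using less.prems(2)[OF K] sum' by linarith
      next
        case KA: True
        have sumK: "(\<Sum>i\<in>K. x $ i) = (\<Sum>i\<in>K \<inter> supp. x $ i)"
          by (rule sum.mono_neutral_right) (auto simp: supp_def)
        show ?thesis
        proof (cases "K \<inter> supp = {}")
          case True
          then show ?thesis using sum' sumK KA \<open>e \<le> t\<close> by simp
        next
          case False
          \<comment> \<open>The least element \<open>m\<close> of the chain within the support lies
            above some \<open>a\<close> in \<open>A\<close>. Adding \<open>a\<close> gives a longer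
            chain, whose sum is still at most \<open>t\<close>, and \<open>a\<close> accounts for at
            least \<open>e\<close> of it.\<close>
          then obtain m where m: "m \<in> K \<inter> supp" "\<And>j. j \<in> K \<inter> supp \<Longrightarrow> le j m \<Longrightarrow> j = m"
            using minimal[of _ "K \<inter> supp"] by blast
          obtain a where a: "a \<in> A" "le a m" using A_below m(1) by blast
          have "le a j" if "j \<in> K \<inter> supp" for j
            using that m chain[of j m] le_trans[OF a(2)] a(2) by blast
          then have "independent_in (incomp_graph P p) (insert a (K \<inter> supp))"
            using chain by (auto simp: independent_in_def g)
          from less.prems(2)[OF this] have "x $ a + (\<Sum>i\<in>K \<inter> supp. x $ i) \<le> t"
            using KA a(1) by (subst (asm) sum.insert) auto
          then show ?thesis using sum' sumK KA e_le[OF a(1)] by simp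
        qed
      qed
    qed
    ultimately obtain y' where y': "y' \<in> chain_polytope P p" "x' = (t - e) *\<^sub>R y'"
      using less.hyps[of x' "t - e"] by blast
    have "t > 0" using \<open>e > 0\<close> \<open>e \<le> t\<close> by linarith
    define y where "y = (e / t) *\<^sub>R indicator_vec A + ((t - e) / t) *\<^sub>R y'"
    have "indicator_vec A \<in> chain_polytope P p"
      by (rule antichain_in_chain_polytope[OF p]) (auto simp: g A_def)
    then have "y \<in> chain_polytope P p"
      unfolding y_def using y'(1) \<open>t > 0\<close> \<open>e > 0\<close> \<open>e \<le> t\<close>
      by (intro convexD[of "chain_polytope P p"]) (auto simp: chain_polytope_def diff_divide_distrib)
    moreover have "x = t *\<^sub>R y"
    proof -
      have "t *\<^sub>R y = e *\<^sub>R indicator_vec A + (t - e) *\<^sub>R y'" using \<open>t > 0\<close> by (simp add: y_def scaleR_right_distrib)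
      moreover have "x = e *\<^sub>R indicator_vec A + x'" by (simp add: x'_def)
      ultimately show ?thesis using y'(2) by simp
    qed
    ultimately show ?thesis by blast
  qed
qed

definition pair_vec :: "'n::finite set \<times> 'n set \<Rightarrow> real ^ 'n" where
  "pair_vec e = indicator_vec (fst e) - indicator_vec (snd e)"

lemma inner_pair_vec: "pair_vec (C, D) \<bullet> x = (\<Sum>i\<in>C. x $ i) - (\<Sum>i\<in>D. x $ i)"
  by (simp add: pair_vec_def inner_diff_left inner_indicator_vec)

lemma sum_indicator_vec_nonneg: "0 \<le> (\<Sum>i\<in>K. indicator_vec S $ i)"
  by (rule sum_nonneg) (simp add: indicator_vec_def)

text \<open>A chain and an antichain share at most one element.\<close>

lemma chain_antichain_sum:
  assumes "\<forall>i\<in>S. \<forall>j\<in>S. i \<noteq> j \<longrightarrow> incomp_graph P p i j" "independent_in (incomp_graph P p) (K :: 'n::finite set)"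
  shows "(\<Sum>i\<in>K. indicator_vec S $ i) \<le> 1"
proof -
  have eq: "(\<Sum>i\<in>K. indicator_vec S $ i) = real (card (K \<inter> S))"
    by (simp add: indicator_vec_def sum.If_cases)
  have "i = j" if "i \<in> K \<inter> S" "j \<in> K \<inter> S" for i j
    using assms that by (auto simp: independent_in_def)
  then have "card (K \<inter> S) \<le> Suc 0" by (subst card_le_Suc0_iff_eq) auto
  then show ?thesis unfolding eq by simp
qed

text \<open>The missing weight \<open>1 - (s + t)\<close> is put on the origin.\<close>

lemma convex_scaled_sum:
  fixes a b :: "'v::real_vector"
  assumes "convex H" "0 \<in> H" "a \<in> H" "b \<in> H" "0 \<le> s" "0 \<le> t" "s + t \<le> 1"
  shows "s *\<^sub>R a + t *\<^sub>R b \<in> H"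
proof (cases "s + t = 0")
  case True then show ?thesis using assms by (simp add: add_nonneg_eq_0_iff)
next
  case False
  define y where "y = (s / (s + t)) *\<^sub>R a + (t / (s + t)) *\<^sub>R b"
  have "y \<in> H" unfolding y_def
    using assms False by (intro convexD[OF assms(1)]) (auto simp: add_divide_distrib[symmetric])
  then have "(s + t) *\<^sub>R y + (1 - (s + t)) *\<^sub>R 0 \<in> H"
    using assms by (intro convexD[OF assms(1)]) auto
  moreover have "(s + t) *\<^sub>R y = s *\<^sub>R a + t *\<^sub>R b"
    using False by (simp add: y_def scaleR_right_distrib)
  ultimately show ?thesis by simp
qed

lemma max_chain_sum:
  fixes f :: "'n::finite \<Rightarrow> real"
  obtains K where "independent_in g K" "\<And>K'. independent_in g K' \<Longrightarrow> sum f K' \<le> sum f K"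
proof -
  let ?X = "sum f ` {K. independent_in g K}"
  have "independent_in g {}" by (simp add: independent_in_def)
  then have "Max ?X \<in> ?X" by (intro Max_in) auto
  then obtain K where "independent_in g K" "Max ?X = sum f K" by auto
  moreover have "sum f K' \<le> Max ?X" if "independent_in g K'" for K' using that by (intro Max_ge) auto
  ultimately show ?thesis using that by simp
qed

lemma independent_in_subset: "independent_in g K \<Longrightarrow> K' \<subseteq> K \<Longrightarrow> independent_in g K'"
  by (auto simp: independent_in_def)

text \<open>One inclusion is checked on the generating points. For the other, the positive and
  negative parts of \<open>x\<close> lie in the chain polytopes scaled by their largest chain sums
  \<open>s\<close> and \<open>t\<close>, and the inequality of a suitable pair gives
  \<open>s + t \<le> 1\<close>.\<close>

lemma twinned_chain_polytope_eq:
  fixes p q :: "'n::finite \<Rightarrow> 'a"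
  assumes P: "is_poset P" and Q: "is_poset Q" and p: "bij_betw p UNIV (fst P)" and q: "bij_betw q UNIV (fst Q)"
  shows "twinned_chain_polytope P p Q q =
    {x. \<forall>e\<in>indep_pairs (incomp_graph P p) (incomp_graph Q q) UNIV. pair_vec e \<bullet> x \<le> 1}" (is "?G = ?S")
proof
  let ?g = "incomp_graph P p" and ?h = "incomp_graph Q q"
  have "?S = (\<Inter>e\<in>indep_pairs ?g ?h UNIV. {x. pair_vec e \<bullet> x \<le> 1})" by auto
  then have conv: "convex ?S" by (simp add: convex_INT convex_halfspace_le)
  have "chain_polytope P p \<subseteq> ?S"
    unfolding chain_polytope_def antichain_points[OF p]
  proof (rule hull_minimal, clarify)
    show "convex ?S" by (rule conv)
    fix S C D assume S: "\<forall>i\<in>S. \<forall>j\<in>S. i \<noteq> j \<longrightarrow> ?g i j" and "(C, D) \<in> indep_pairs ?g ?h UNIV"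
    then have "independent_in ?g C" by (simp add: indep_pairs_def)
    from chain_antichain_sum[OF S this] show "pair_vec (C, D) \<bullet> indicator_vec S \<le> 1"
      unfolding inner_pair_vec using sum_indicator_vec_nonneg[of S D] by linarith
  qed
  moreover have "chain_polytope Q q \<subseteq> uminus ` ?S"
    unfolding chain_polytope_def antichain_points[OF q]
  proof (rule hull_minimal)
    show "convex (uminus ` ?S)" using conv by (rule convex_negations)
    show "indicator_vec ` {S. \<forall>i\<in>S. \<forall>j\<in>S. i \<noteq> j \<longrightarrow> ?h i j} \<subseteq> uminus ` ?S"
    proof clarify
      fix S assume S: "\<forall>i\<in>S. \<forall>j\<in>S. i \<noteq> j \<longrightarrow> ?h i j"
      have "pair_vec e \<bullet> (- indicator_vec S) \<le> 1" if "e \<in> indep_pairs ?g ?h UNIV" for e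
      proof -
        obtain C D where e: "e = (C, D)" by (cases e)
        then have "independent_in ?h D" using that by (simp add: indep_pairs_def)
        from chain_antichain_sum[OF S this] show ?thesis
          unfolding e inner_minus_right inner_pair_vec
          using sum_indicator_vec_nonneg[of S C] by linarith
      qed
      then show "indicator_vec S \<in> uminus ` ?S" by (intro image_eqI[of _ _ "- indicator_vec S"]) auto
    qed
  qed
  then have "uminus ` chain_polytope Q q \<subseteq> ?S" by force
  ultimately show "?G \<subseteq> ?S"
    unfolding twinned_chain_polytope_def using conv by (intro hull_minimal) auto
  show "?S \<subseteq> ?G"
  proof
    fix x assume x: "x \<in> ?S"
    define xp where "xp = (\<chi> i. max (x $ i) 0)"
    define xm where "xm = (\<chi> i. max (- x $ i) 0)"
    obtain C0 where C0: "independent_in ?g C0" "\<And>K. independent_in ?g K \<Longrightarrow> (\<Sum>i\<in>K. xp $ i) \<le> (\<Sum>i\<in>C0. xp $ i)"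
      using max_chain_sum[of ?g "\<lambda>i. xp $ i"] by blast
    obtain D0 where D0: "independent_in ?h D0" "\<And>K. independent_in ?h K \<Longrightarrow> (\<Sum>i\<in>K. xm $ i) \<le> (\<Sum>i\<in>D0. xm $ i)"
      using max_chain_sum[of ?h "\<lambda>i. xm $ i"] by blast
    define s where "s = (\<Sum>i\<in>C0. xp $ i)"
    define t where "t = (\<Sum>i\<in>D0. xm $ i)"
    \<comment> \<open>Restricting the optimal chains to the coordinates of the right sign keeps both
      sums and makes the chains disjoint.\<close>
    define C where "C = C0 \<inter> {i. x $ i > 0}"
    define D where "D = D0 \<inter> {i. x $ i < 0}"
    have "(C, D) \<in> indep_pairs ?g ?h UNIV"
      using independent_in_subset[OF C0(1), of C] independent_in_subset[OF D0(1), of D]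
      by (auto simp: indep_pairs_def C_def D_def)
    then have "pair_vec (C, D) \<bullet> x \<le> 1" using x by blast
    moreover have "s = (\<Sum>i\<in>C. x $ i)"
      unfolding s_def C_def by (rule sum.mono_neutral_cong_right) (auto simp: xp_def)
    moreover have "t = - (\<Sum>i\<in>D. x $ i)"
      unfolding t_def D_def sum_negf[symmetric] by (rule sum.mono_neutral_cong_right) (auto simp: xm_def)
    ultimately have st: "s + t \<le> 1" by (simp add: inner_pair_vec)
    have st0: "0 \<le> s" "0 \<le> t" by (auto simp: s_def t_def xp_def xm_def intro!: sum_nonneg)
    obtain a where a: "a \<in> chain_polytope P p" "xp = s *\<^sub>R a"
      using chain_polytope_scaled[OF P p, of xp s] C0(2) by (auto simp: s_def xp_def)
    obtain b where b: "b \<in> chain_polytope Q q" "xm = t *\<^sub>R b"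
      using chain_polytope_scaled[OF Q q, of xm t] D0(2) by (auto simp: t_def xm_def)
    have "a \<in> ?G" "- b \<in> ?G" "0 \<in> ?G"
      using a(1) b(1) zero_in_chain_polytope[OF p] unfolding twinned_chain_polytope_def
      by (auto intro!: hull_inc)
    then have "s *\<^sub>R a + t *\<^sub>R (- b) \<in> ?G"
      using st st0 by (intro convex_scaled_sum) (auto simp: twinned_chain_polytope_def)
    moreover have "x = s *\<^sub>R a + t *\<^sub>R (- b)"
    proof -
      have "x = xp - xm" by (auto simp: vec_eq_iff xp_def xm_def max_def)
      then show ?thesis using a(2) b(2) by simp
    qed
    ultimately show "x \<in> ?G" by simp
  qed
qed

text \<open>A pair extendable by \<open>i\<close> on either side gives a redundant inequality, being the average of the
  two inequalities of the extended pairs.\<close>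

lemma dominating_pairs_suffice:
  fixes x :: "real ^ 'v::finite"
  assumes "two_graphs g h"
    and suffice: "\<And>e. e \<in> dominating_pairs g h UNIV \<Longrightarrow> pair_vec e \<bullet> x \<le> 1" and "e \<in> indep_pairs g h UNIV"
  shows "pair_vec e \<bullet> x \<le> 1"
  using assms(3)
proof (induction "card (UNIV - fst e - snd e)" arbitrary: e rule: less_induct)
  case less
  interpret two_graphs g h by fact
  obtain C D where e: "e = (C, D)" by (cases e)
  have CD: "C \<inter> D = {}" "independent_in g C" "independent_in h D"
    using less.prems by (auto simp: e indep_pairs_def)
  show ?case
  proof (cases "e \<in> dominating_pairs g h UNIV")
    case True then show ?thesis by (rule suffice)
  next
    case False
    then obtain i where i: "i \<notin> C" "i \<notin> D" "\<And>y. y \<in> C \<Longrightarrow> \<not> g i y" "\<And>y. y \<in> D \<Longrightarrow> \<not> h i y"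
      using less.prems by (auto simp: dominating_pairs_def e)
    then have i': "\<And>y. y \<in> C \<Longrightarrow> \<not> g y i" "\<And>y. y \<in> D \<Longrightarrow> \<not> h y i" using g_sym h_sym by blast+
    have "independent_in g (insert i C)" "independent_in h (insert i D)"
      using CD i i' g_irrefl h_irrefl by (auto simp: independent_in_def)
    then have "(insert i C, D) \<in> indep_pairs g h UNIV" "(C, insert i D) \<in> indep_pairs g h UNIV"
      using CD i by (auto simp: indep_pairs_def)
    moreover have "UNIV - insert i C - D \<subset> UNIV - C - D" "UNIV - C - insert i D \<subset> UNIV - C - D"
      using i(1,2) by blast+
    then have "card (UNIV - insert i C - D) < card (UNIV - C - D)"
      "card (UNIV - C - insert i D) < card (UNIV - C - D)"
      by (simp_all only: psubset_card_mono finite)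
    ultimately have "pair_vec (insert i C, D) \<bullet> x \<le> 1" "pair_vec (C, insert i D) \<bullet> x \<le> 1"
      using less.hyps[of "(insert i C, D)"] less.hyps[of "(C, insert i D)"] unfolding e fst_conv snd_conv by blast+
    then show ?thesis using i(1,2) by (simp add: inner_pair_vec e)
  qed
qed

text \<open>The separating point is \<open>pair_vec e\<close>, perturbed on the unused coordinates towards the
  sign with which that coordinate cannot be added to \<open>e\<close>.\<close>

lemma dominating_pair_separated:
  assumes e: "e \<in> dominating_pairs g h (UNIV :: 'v::finite set)"
  shows "\<exists>y. pair_vec e \<bullet> y > 0 \<and> (\<forall>e'\<in>dominating_pairs g h UNIV. e' \<noteq> e \<longrightarrow> pair_vec e' \<bullet> y < pair_vec e \<bullet> y)"
proof -
  obtain C D where CDe: "e = (C, D)" by (cases e)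
  have CD: "C \<inter> D = {}" "independent_in g C" "independent_in h D"
    and dom: "\<And>i. i \<notin> C \<Longrightarrow> i \<notin> D \<Longrightarrow> (\<exists>j\<in>C. g i j) \<or> (\<exists>j\<in>D. h i j)"
    using e by (auto simp: CDe dominating_pairs_def indep_pairs_def)
  \<comment> \<open>The perturbations total at most \<open>1 / 2\<close>, less than the unit lost by
    dropping a coordinate of \<open>e\<close>.\<close>
  define r where "r = 1 / (2 * real CARD('v))"
  have r: "r > 0" "r * real CARD('v) = 1 / 2" by (simp_all add: r_def)
  define y :: "real ^ 'v" where
    "y = (\<chi> i. if i \<in> C then 1 else if i \<in> D then - 1 else if \<exists>j\<in>C. g i j then r else - r)"
  have coord: "pair_vec (A, B) $ i = (if i \<in> A then 1 else 0) - (if i \<in> B then 1 else 0)" for A B i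
    by (simp add: pair_vec_def indicator_vec_def)
  have val: "pair_vec e \<bullet> y = card C + card D"
  proof -
    have "y $ i = - 1" if "i \<in> D" for i using that CD(1) by (auto simp: y_def)
    then have "(\<Sum>i\<in>D. y $ i) = (\<Sum>i\<in>D. - 1)" by (intro sum.cong) auto
    moreover have "(\<Sum>i\<in>C. y $ i) = (\<Sum>i\<in>C. 1)" by (intro sum.cong) (auto simp: y_def)
    ultimately show ?thesis by (simp add: CDe inner_pair_vec)
  qed
  have "C \<noteq> {} \<or> D \<noteq> {}" using dom by blast
  then have "card C > 0 \<or> card D > 0" by (simp add: card_gt_0_iff)
  then have pos: "pair_vec e \<bullet> y > 0" unfolding val by linarith
  have "pair_vec e' \<bullet> y < pair_vec e \<bullet> y" if e': "e' \<in> dominating_pairs g h UNIV" "e' \<noteq> e" for e'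
  proof -
    obtain C' D' where CDe': "e' = (C', D')" by (cases e')
    have CD': "C' \<inter> D' = {}" "independent_in g C'" "independent_in h D'"
      using e' by (auto simp: CDe' dominating_pairs_def indep_pairs_def)
    define f where "f i = (pair_vec e $ i - pair_vec e' $ i) * y $ i" for i
    have diff: "pair_vec e \<bullet> y - pair_vec e' \<bullet> y = (\<Sum>i\<in>UNIV. f i)"
      by (simp add: f_def inner_vec_def left_diff_distrib sum_subtractf)
    have "(\<Sum>i\<in>UNIV. f i) > 0"
    proof (cases "C \<subseteq> C' \<and> D \<subseteq> D'")
      case True
      \<comment> \<open>If \<open>e'\<close> extends \<open>e\<close>, every new coordinate enters
        with the sign opposite to that of \<open>y\<close> and so costs exactly
        \<open>r\<close>.\<close>
      have used: "f i = 0" if "i \<in> C \<or> i \<in> D" for i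
        using that True CD CD' by (auto simp: f_def CDe CDe' coord)
      have new: "f i = r" if "i \<notin> C" "i \<notin> D" "i \<in> C' \<or> i \<in> D'" for i
      proof (cases "i \<in> C'")
        case iC: True
        then have "\<not> (\<exists>j\<in>C. g i j)" using True CD'(2) by (auto simp: independent_in_def)
        then show ?thesis using that iC CD'(1) by (auto simp: f_def CDe CDe' coord y_def)
      next
        case iC: False
        then have "i \<in> D'" using that by simp
        then have "\<not> (\<exists>j\<in>D. h i j)" using True CD'(3) by (auto simp: independent_in_def)
        then have "\<exists>j\<in>C. g i j" using dom that by blast
        then show ?thesis using that iC \<open>i \<in> D'\<close> by (auto simp: f_def CDe CDe' coord y_def)
      qed
      have rest: "f i = 0" if "i \<notin> C" "i \<notin> D" "i \<notin> C'" "i \<notin> D'" for i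
        using that by (simp add: f_def CDe CDe' coord)
      have "\<exists>i. i \<notin> C \<and> i \<notin> D \<and> (i \<in> C' \<or> i \<in> D')"
        using True e'(2) CD CD' by (auto simp: CDe CDe')
      then obtain i where i: "f i = r" using new by blast
      have "0 \<le> f j" for j using used[of j] new[of j] rest[of j] r(1) by (cases "j \<in> C \<or> j \<in> D"; cases "j \<in> C' \<or> j \<in> D'") auto
      then have "f i \<le> (\<Sum>i\<in>UNIV. f i)" by (intro member_le_sum) auto
      then show ?thesis using i r(1) by simp
    next
      case False
      \<comment> \<open>Otherwise some coordinate of \<open>e\<close> is missing or reversed in
        \<open>e'\<close>, which costs at least one, and no other coordinate gains more than
        \<open>r\<close>.\<close>
      have low: "- r \<le> f j" for j
        using r(1) CD(1) CD'(1) by (auto simp: f_def CDe CDe' coord y_def)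
      obtain i where i: "i \<in> C \<and> i \<notin> C' \<or> i \<in> D \<and> i \<notin> D'" using False by blast
      then have "1 \<le> f i" using CD(1) by (auto simp: f_def CDe CDe' coord y_def)
      moreover have "(\<Sum>j\<in>UNIV - {i}. - r) \<le> (\<Sum>j\<in>UNIV - {i}. f j)" by (intro sum_mono low)
      moreover have "(\<Sum>j\<in>UNIV. f j) = f i + (\<Sum>j\<in>UNIV - {i}. f j)" by (rule sum.remove) auto
      moreover have "(\<Sum>j\<in>UNIV - {i}. - r) = r - r * real CARD('v)"
        by (simp add: card_Diff_singleton of_nat_diff algebra_simps)
      ultimately show ?thesis using r by linarith
    qed
    then show ?thesis using diff by linarith
  qed
  then show ?thesis using pos by blast
qed

section \<open>Counting the facets and assembling the theorem\<close>

lemma inj_on_pair_vec: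
  fixes g h :: "'n::finite \<Rightarrow> 'n \<Rightarrow> bool"
  shows "inj_on pair_vec (indep_pairs g h UNIV)"
proof (rule inj_onI, clarify)
  fix C D C' D' :: "'n set"
  assume CD: "(C, D) \<in> indep_pairs g h UNIV" "(C', D') \<in> indep_pairs g h UNIV" "pair_vec (C, D) = pair_vec (C', D')"
  have "C = {i. pair_vec (C, D) $ i = 1} \<and> D = {i. pair_vec (C, D) $ i = - 1}"
    if "(C, D) \<in> indep_pairs g h UNIV" for C D :: "'n set"
    using that by (auto simp: indep_pairs_def pair_vec_def indicator_vec_def)
  from this[OF CD(1)] this[OF CD(2)] CD(3) show "C = C' \<and> D = D'" by simp
qed

theorem num_facets_twinned_chain_polytope:
  fixes p q :: "'n::finite \<Rightarrow> 'a"
  assumes "is_poset P" "is_poset Q" "bij_betw p UNIV (fst P)" "bij_betw q UNIV (fst Q)"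
  shows "num_facets (twinned_chain_polytope P p Q q) =
    card (dominating_pairs (incomp_graph P p) (incomp_graph Q q) UNIV)"
proof -
  let ?L = "dominating_pairs (incomp_graph P p) (incomp_graph Q q) UNIV"
  have sub: "?L \<subseteq> indep_pairs (incomp_graph P p) (incomp_graph Q q) UNIV"
    by (auto simp: dominating_pairs_def)
  have "twinned_chain_polytope P p Q q = {x. \<forall>u\<in>pair_vec ` ?L. u \<bullet> x \<le> 1}"
    unfolding twinned_chain_polytope_eq[OF assms]
  proof (intro subset_antisym subsetI CollectI ballI)
    fix x e assume x: "x \<in> {x. \<forall>u\<in>pair_vec ` ?L. u \<bullet> x \<le> 1}"
      and e: "e \<in> indep_pairs (incomp_graph P p) (incomp_graph Q q) UNIV"
    have "pair_vec e' \<bullet> x \<le> 1" if "e' \<in> ?L" for e' using x that by simp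
    from dominating_pairs_suffice[OF two_graphs_incomp this e] show "pair_vec e \<bullet> x \<le> 1" .
  qed (use sub in auto)
  moreover have "num_facets {x. \<forall>u\<in>pair_vec ` ?L. u \<bullet> x \<le> 1} = card (pair_vec ` ?L)"
  proof (rule num_facets_halfspaces)
    show "finite (pair_vec ` ?L)" by (simp add: finite_dominating_pairs)
    fix u assume "u \<in> pair_vec ` ?L"
    then obtain e where e: "e \<in> ?L" "u = pair_vec e" by blast
    from dominating_pair_separated[OF e(1)] obtain y where
      "pair_vec e \<bullet> y > 0" "\<forall>e'\<in>?L. e' \<noteq> e \<longrightarrow> pair_vec e' \<bullet> y < pair_vec e \<bullet> y" by blast
    then show "\<exists>y. u \<bullet> y > 0 \<and> (\<forall>u'\<in>pair_vec ` ?L - {u}. u' \<bullet> y < u \<bullet> y)"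
      unfolding e(2) by (intro exI[of _ y]) auto
  qed
  moreover have "card (pair_vec ` ?L) = card ?L"
    by (rule card_image) (rule inj_on_subset[OF inj_on_pair_vec sub])
  ultimately show ?thesis by simp
qed

theorem theorem1p2:
  fixes P Q :: "'a poset"
    and p q :: "'n::finite \<Rightarrow> 'a"
    and d :: nat
  assumes "is_poset P" and "is_poset Q"
    and "bij_betw p UNIV (fst P)" and "bij_betw q UNIV (fst Q)"
    and "fst P \<inter> fst Q = {}"
    and "d = CARD('n)"
  shows "real (num_facets (twinned_chain_polytope P p Q q)) \<le>
           (if even d then 6 ^ (d div 2) else 14 * 6 powr ((real d - 3) / 2)) \<and>
         (even d \<longrightarrow>
           (num_facets (twinned_chain_polytope P p Q q) = 6 ^ (d div 2) \<longleftrightarrow>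
             poset_iso P (ordinal_sum_I2 (d div 2)) \<and>
             poset_iso Q (ordinal_sum_I2 (d div 2)) \<and>
             graph_isomorphism (q \<circ> inv p) (comparability_graph P) (comparability_graph Q)))"
proof
  interpret two_graphs "incomp_graph P p" "incomp_graph Q q" by (rule two_graphs_incomp)
  note N = num_facets_twinned_chain_polytope[OF assms(1-4)]
  have "facet_bound (int d) = (if even d then 6 ^ (d div 2) else 14 * 6 powr ((real d - 3) / 2))"
  proof (cases "even d")
    case True
    then show ?thesis by (simp add: facet_bound_def power_int_def nat_div_distrib)
  next
    case False
    then obtain m where m: "d = 2 * m + 1" by (elim oddE)
    \<comment> \<open>The real exponent also covers \<open>d = 1\<close>, where it equals
      \<open>-1\<close> and the bound is \<open>7 / 3\<close>, the value of
      \<open>facet_bound\<close>.\<close>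
    have "(real d - 3) / 2 = real m - 1" by (simp add: m field_simps)
    then have "14 * 6 powr ((real d - 3) / 2) = 14 * 6 powr (real m - 1)" by (rule arg_cong)
    also have "\<dots> = 7 / 3 * 6 ^ m" by (simp add: powr_diff powr_realpow)
    finally have "14 * 6 powr ((real d - 3) / 2) = 7 / 3 * 6 ^ m" .
    moreover have "facet_bound (int d) = 7 / 3 * 6 ^ m"
      by (simp add: facet_bound_def m power_int_def nat_add_distrib nat_mult_distrib)
    ultimately show ?thesis using False by simp
  qed
  then show "real (num_facets (twinned_chain_polytope P p Q q)) \<le>
      (if even d then 6 ^ (d div 2) else 14 * 6 powr ((real d - 3) / 2))"
    using card_dominating_pairs_le[of UNIV] by (simp add: N assms(6))
  show "even d \<longrightarrow> (num_facets (twinned_chain_polytope P p Q q) = 6 ^ (d div 2) \<longleftrightarrow>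
      poset_iso P (ordinal_sum_I2 (d div 2)) \<and> poset_iso Q (ordinal_sum_I2 (d div 2)) \<and>
      graph_isomorphism (q \<circ> inv p) (comparability_graph P) (comparability_graph Q))"
    unfolding N assms(6) using extremal_iff[OF assms(1-4)] by blast
qed

end
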